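(* Let $p\in(0,1)$, $q=1-p$ and $g(p)=\sqrt{1+2p-3p^2}$. Let $A\subseteq[0,n-1]$ be random with each element included independently with probability $p$, and let $m_{n;p}(k):=\mathbb{P}(2n-1-|A+A|=k)$. Then there are constants $c_1,c_2>0$ depending only on $p$ (not on $n$ or $k$) such that for all nonnegative integers $k$ and all $n$ with $n>2\frac{\log(1-p)}{\log(1-p^2)}k$, $$c_1\,q^{k/2}\ \le\ m_{n;p}(k)\ \le\ c_2\left(\frac{1-p+g(p)}{2}\right)^k.$$
   Context: $[a,b]$ denotes the integers from $a$ to $b$; $A+A=\{a+a':a,a'\in A\}\subseteq[0,2n-2]$, so $2n-1-|A+A|$ is the number of missing sums.
   Formalization: The lower bound is stated for all pairs except (n,k)=(3,1): for p close to 1 this pair meets the condition on n, but no subset of [0,2] has exactly one missing sum, so m_{3;p}(1)=0 and the lower bound fails there. *)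

theory Defs
  imports "HOL-Probability.Probability" "HOL-Library.Set_Algebras"
begin

definition random_subset :: "nat \<Rightarrow> real \<Rightarrow> nat set pmf" where
  "random_subset n p =
     map_pmf (\<lambda>b. {i \<in> {0..<n}. b i}) (Pi_pmf {0..<n} False (\<lambda>_. bernoulli_pmf p))"

text \<open>
  Here \<open>A + A\<close> is the sumset operation of \<open>Set_Algebras\<close>. The number of missing sums
  is computed in the integers to avoid truncated subtraction.
\<close>

definition missing_sums_prob :: "nat \<Rightarrow> real \<Rightarrow> nat \<Rightarrow> real" where
  "missing_sums_prob n p k =
     measure_pmf.prob (random_subset n p) {A. 2 * int n - 1 - int (card (A + A)) = int k}"

definition g :: "real \<Rightarrow> real" where
  "g p = sqrt (1 + 2 * p - 3 * p\<^sup>2)"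

text \<open>
  No subset of \<open>{0, 1, 2}\<close> has exactly one missing sum, although for \<open>p\<close> close to \<open>1\<close> the pair
  \<open>n = 3\<close>, \<open>k = 1\<close> satisfies \<open>n > 2 * (ln (1 - p) / ln (1 - p\<^sup>2)) * k\<close>. A positive lower
  bound on \<open>missing_sums_prob n p k\<close> under that condition must therefore leave out this pair.
\<close>

lemma missing_sums_prob_3_1: "missing_sums_prob 3 p 1 = 0"
proof -
  have *: "card (A + A) \<noteq> 4" if "A \<subseteq> {0..<3}" for A :: "nat set"
  proof -
    have A: "A \<subseteq> {0, 1, 2}"
      using that by (force simp: subset_iff)
    have "{0, 1, 2} + {0, 1, 2} \<subseteq> {0, 1, 2, 3, 4 :: nat}"
      by (auto simp: set_plus_def)
    with set_plus_mono2[OF A A] have sub: "A + A \<subseteq> {0, 1, 2, 3, 4}" by blast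
    show ?thesis
    proof (cases "A = {0, 1, 2}")
      case True
      have "{0, 1, 2, 3, 4} \<subseteq> A + A"
        by (auto simp: True set_plus_def)
      with sub have "A + A = {0, 1, 2, 3, 4}" by blast
      then show ?thesis by simp
    next
      case False
      have "A \<subset> {0, 1, 2}" using False A by blast
      then have "A \<subseteq> {1, 2} \<or> A \<subseteq> {0, 2} \<or> A \<subseteq> {0, 1}" by blast
      then obtain S where S: "A + A \<subseteq> S" "finite S" "card S \<le> 3"
      proof (elim disjE)
        assume *: "A \<subseteq> {1, 2}"
        have "{1, 2} + {1, 2 :: nat} \<subseteq> {2, 3, 4}" by (auto simp: set_plus_def)
        with set_plus_mono2[OF * *] have "A + A \<subseteq> {2, 3, 4}" by blast
        then show thesis by (rule that) auto
      next
        assume *: "A \<subseteq> {0, 2}"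
        have "{0, 2} + {0, 2 :: nat} \<subseteq> {0, 2, 4}" by (auto simp: set_plus_def)
        with set_plus_mono2[OF * *] have "A + A \<subseteq> {0, 2, 4}" by blast
        then show thesis by (rule that) auto
      next
        assume *: "A \<subseteq> {0, 1}"
        have "{0, 1} + {0, 1 :: nat} \<subseteq> {0, 1, 2}" by (auto simp: set_plus_def)
        with set_plus_mono2[OF * *] have "A + A \<subseteq> {0, 1, 2}" by blast
        then show thesis by (rule that) auto
      qed
      then show ?thesis using card_mono[OF S(2,1)] by simp
    qed
  qed
  have "set_pmf (random_subset 3 p) \<subseteq> Pow {0..<3}"
    by (auto simp: random_subset_def)
  then have "set_pmf (random_subset 3 p) \<inter> {A. 2 * int 3 - 1 - int (card (A + A)) = int 1} = {}"
    (is "?R \<inter> ?M = {}")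
  proof -
    assume sub: "?R \<subseteq> Pow {0..<3}"
    have "A \<notin> ?M" if "A \<in> ?R" for A
    proof -
      have "card (A + A) \<noteq> 4" using sub that * by blast
      then show ?thesis by simp
    qed
    then show ?thesis by blast
  qed
  then have "measure_pmf.prob (random_subset 3 p) ?M = 0"
    by (simp only: measure_pmf_zero_iff)
  then show ?thesis
    unfolding missing_sums_prob_def .
qed

lemma size_condition_3_1: "real 3 > 2 * (ln (1 - 9/10) / ln (1 - (9/10)\<^sup>2)) * real 1"
proof -
  have "3 * ln (19/100 :: real) = ln ((19/100) ^ 3)" by (simp add: ln_realpow)
  also have "\<dots> < ln ((1/10) ^ 2)" by (subst ln_less_cancel_iff) (simp_all add: eval_nat_numeral)
  also have "\<dots> = 2 * ln (1/10 :: real)" by (simp add: ln_realpow)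
  finally have "3 * ln (19/100 :: real) < 2 * ln (1/10)" .
  moreover have "ln (19/100 :: real) < 0" by simp
  ultimately show ?thesis
    by (simp add: power2_eq_square field_simps)
qed

end

theory Submission
  imports Defs
begin

text \<open>
  Write \<open>lam = (1 - p + g p) / 2\<close> and \<open>\<beta> = sqrt (1 - p\<^sup>2)\<close>; then
  \<open>lam\<^sup>2 = (1 - p) * lam + p * (1 - p)\<close> and \<open>1 - p < lam\<^sup>2 < 1\<close>.

  Upper bound. A sum \<open>s\<close> is missing with probability at most \<open>\<beta>\<close> to the distance of \<open>s\<close> from the
  nearer end of \<open>{0..2 * n - 2}\<close>, so up to an error \<open>O(lam ^ k)\<close> all missing sums lie near the two
  ends, where they depend on the two independent halves of \<open>A\<close>. Two sums \<open>i < j\<close> are both missing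
  with probability at most \<open>lam ^ i\<close>, because then \<open>A\<close> is an independent set in a union of paths.
  If \<open>l\<close> sums are missing at the lower end, then either two of them exceed \<open>(1 + \<delta>) * l\<close>, or almost
  all sums below \<open>l\<close> are missing, and \<open>A\<close> has at most about \<open>\<delta> * l\<close> elements below \<open>l / 2\<close>. Both
  events have probability \<open>O(\<rho> ^ l)\<close> for some \<open>\<rho> < lam\<close>.

  Lower bound. Let \<open>A\<close> avoid \<open>{0..<k div 2}\<close>, which accounts for \<open>2 * (k div 2)\<close> missing sums; with
  probability bounded below the rest of \<open>A\<close> misses no sum, or exactly one if \<open>k\<close> is odd.
\<close>

section \<open>Random subsets with independent elements\<close>

text \<open>For \<open>V = {0..<n}\<close> this is \<open>random_subset n p\<close>. Arbitrary
  ground sets are allowed because the proof splits them into independent blocks and shifts or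
  reflects them.\<close>

definition bernoulli_subset :: "real \<Rightarrow> 'a set \<Rightarrow> 'a set pmf" where
  "bernoulli_subset p V =
     map_pmf (\<lambda>b. {i \<in> V. b i}) (Pi_pmf V False (\<lambda>_. bernoulli_pmf p))"

locale bernoulli =
  fixes p :: real
  assumes p_pos: "0 < p" and p_less_1: "p < 1"
begin

abbreviation subset_prob :: "'a set \<Rightarrow> ('a set \<Rightarrow> bool) \<Rightarrow> real" where
  "subset_prob V E \<equiv> measure_pmf.prob (bernoulli_subset p V) {A. E A}"

lemma set_bernoulli_subset: "set_pmf (bernoulli_subset p V) \<subseteq> Pow V"
  by (auto simp: bernoulli_subset_def)

lemma subset_prob_mono:
  assumes "\<And>A. A \<subseteq> V \<Longrightarrow> E A \<Longrightarrow> F A"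
  shows "subset_prob V E \<le> subset_prob V F"
proof -
  have "subset_prob V E = measure_pmf.prob (bernoulli_subset p V) ({A. E A} \<inter> set_pmf (bernoulli_subset p V))"
    by (simp add: measure_Int_set_pmf)
  also have "\<dots> \<le> subset_prob V F"
    by (rule measure_pmf.finite_measure_mono) (use assms set_bernoulli_subset[of V] in auto)
  finally show ?thesis .
qed

lemma subset_prob_cong:
  assumes "\<And>A. A \<subseteq> V \<Longrightarrow> E A \<longleftrightarrow> F A"
  shows "subset_prob V E = subset_prob V F"
  by (intro antisym subset_prob_mono) (use assms in auto)

lemma subset_prob_union_le:
  assumes "finite I"
  shows "subset_prob V (\<lambda>A. \<exists>i\<in>I. E i A) \<le> (\<Sum>i\<in>I. subset_prob V (E i))"
proof -
  have "{A. \<exists>i\<in>I. E i A} = (\<Union>i\<in>I. {A. E i A})" by auto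
  then show ?thesis
    using measure_pmf.finite_measure_subadditive_finite[OF assms, of "\<lambda>i. {A. E i A}"] by simp
qed

lemma subset_prob_disj_le:
  "subset_prob V (\<lambda>A. E A \<or> F A) \<le> subset_prob V E + subset_prob V F"
proof -
  have "{A. E A \<or> F A} = {A. E A} \<union> {A. F A}" by auto
  then show ?thesis by (simp add: measure_Un_le)
qed

lemma subset_prob_Not: "subset_prob V (\<lambda>A. \<not> E A) = 1 - subset_prob V E"
proof -
  have "{A. \<not> E A} = UNIV - {A. E A}" by auto
  then show ?thesis using measure_pmf.prob_compl[of "{A. E A}" "bernoulli_subset p V"] by simp
qed

lemma bernoulli_subset_empty [simp]: "bernoulli_subset p {} = return_pmf {}"
  by (simp add: bernoulli_subset_def)

lemma bernoulli_subset_Un: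
  assumes "finite V" "finite W" "V \<inter> W = {}"
  shows "bernoulli_subset p (V \<union> W) =
    map_pmf (\<lambda>(A, B). A \<union> B) (pair_pmf (bernoulli_subset p V) (bernoulli_subset p W))"
  unfolding bernoulli_subset_def map_pair[symmetric] Pi_pmf_union[OF assms] map_pmf_comp
  by (intro map_pmf_cong refl) (use assms in \<open>auto split: if_splits\<close>)

lemma subset_prob_indep:
  assumes "finite V" "finite W" "V \<inter> W = {}"
  shows "subset_prob (V \<union> W) (\<lambda>A. E (A \<inter> V) \<and> F (A \<inter> W)) = subset_prob V E * subset_prob W F"
proof -
  let ?M = "bernoulli_subset p V" and ?N = "bernoulli_subset p W"
  have sub: "A \<subseteq> V" "B \<subseteq> W" if "A \<in> set_pmf ?M" "B \<in> set_pmf ?N" for A B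
    using that set_bernoulli_subset by blast+
  have eq: "(A \<union> B) \<inter> V = A" "(A \<union> B) \<inter> W = B" if "A \<subseteq> V" "B \<subseteq> W" for A B
    using that assms(3) by blast+
  have "subset_prob (V \<union> W) (\<lambda>A. E (A \<inter> V) \<and> F (A \<inter> W)) =
    measure_pmf.prob (pair_pmf ?M ?N)
      ({x. E ((fst x \<union> snd x) \<inter> V) \<and> F ((fst x \<union> snd x) \<inter> W)} \<inter> set_pmf (pair_pmf ?M ?N))"
    unfolding bernoulli_subset_Un[OF assms] measure_Int_set_pmf
    by (simp add: vimage_def case_prod_beta)
  also have "{x. E ((fst x \<union> snd x) \<inter> V) \<and> F ((fst x \<union> snd x) \<inter> W)} \<inter> set_pmf (pair_pmf ?M ?N) =
      ({A. E A} \<inter> set_pmf ?M) \<times> ({B. F B} \<inter> set_pmf ?N)"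
    using sub by (auto simp: eq)
  also have "measure_pmf.prob (pair_pmf ?M ?N) \<dots> = subset_prob V E * subset_prob W F"
    by (subst measure_pmf_prob_product) (auto simp: measure_Int_set_pmf)
  finally show ?thesis .
qed

lemma subset_prob_Int:
  assumes "finite W" "V \<subseteq> W"
  shows "subset_prob W (\<lambda>A. E (A \<inter> V)) = subset_prob V E"
proof -
  have "subset_prob (V \<union> (W - V)) (\<lambda>A. E (A \<inter> V) \<and> True) = subset_prob V E * subset_prob (W - V) (\<lambda>_. True)"
    by (rule subset_prob_indep) (use assms in \<open>auto dest: finite_subset\<close>)
  moreover have "V \<union> (W - V) = W" using assms by blast
  ultimately show ?thesis by simp
qed

text \<open>Conditioning on whether \<open>x\<close> is chosen. The explicit probabilities and most
  inductions below come from this recursion.\<close>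

lemma subset_prob_insert:
  assumes "finite V" "x \<notin> V"
  shows "subset_prob (insert x V) E = p * subset_prob V (\<lambda>A. E (insert x A)) + (1 - p) * subset_prob V E"
proof -
  have Collect_id: "{b. b} = {True}" by auto
  have single: "subset_prob {x} (\<lambda>A. x \<in> A) = p"
    unfolding bernoulli_subset_def Pi_pmf_singleton map_pmf_comp
    using p_pos p_less_1 measure_pmf_single[of "bernoulli_pmf p" True]
    by (simp add: vimage_def Collect_id)
  have cut: "subset_prob (insert x V) (\<lambda>A. (x \<in> A) = b \<and> E A) =
      subset_prob {x} (\<lambda>A. (x \<in> A) = b) * subset_prob V (\<lambda>A. E (if b then insert x A else A))" for b
  proof -
    have "subset_prob (insert x V) (\<lambda>A. (x \<in> A) = b \<and> E A) =
        subset_prob ({x} \<union> V) (\<lambda>A. (x \<in> A \<inter> {x}) = b \<and> E (if b then insert x (A \<inter> V) else A \<inter> V))"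
    proof (unfold insert_is_Un[symmetric], rule subset_prob_cong)
      fix A assume "A \<subseteq> insert x V"
      then have "insert x (A \<inter> V) = A" if "x \<in> A" using that by blast
      moreover have "A \<inter> V = A" if "x \<notin> A" using that \<open>A \<subseteq> insert x V\<close> by blast
      moreover have "x \<in> A \<inter> {x} \<longleftrightarrow> x \<in> A" by simp
      ultimately show "((x \<in> A) = b \<and> E A) \<longleftrightarrow>
          ((x \<in> A \<inter> {x}) = b \<and> E (if b then insert x (A \<inter> V) else A \<inter> V))"
        by (smt (verit))
    qed
    also have "\<dots> = subset_prob {x} (\<lambda>A. (x \<in> A) = b) * subset_prob V (\<lambda>A. E (if b then insert x A else A))"
      by (rule subset_prob_indep) (use assms in auto)
    finally show ?thesis .
  qed
  have "{A. E A} = {A. (x \<in> A) = True \<and> E A} \<union> {A. (x \<in> A) = False \<and> E A}" by auto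
  then have "subset_prob (insert x V) E =
      subset_prob (insert x V) (\<lambda>A. (x \<in> A) = True \<and> E A) + subset_prob (insert x V) (\<lambda>A. (x \<in> A) = False \<and> E A)"
    by (simp add: measure_pmf.finite_measure_Union[symmetric] disjoint_iff)
  then show ?thesis
    unfolding cut using single by (simp add: subset_prob_Not)
qed

lemma subset_prob_image:
  assumes "finite V" "inj_on f V"
  shows "subset_prob (f ` V) E = subset_prob V (\<lambda>A. E (f ` A))"
  using assms
proof (induction V arbitrary: E rule: finite_induct)
  case empty
  then show ?case by (simp add: indicator_def)
next
  case (insert x V)
  then have "f x \<notin> f ` V" "inj_on f V" by (auto simp: inj_on_def)
  then show ?case
    using insert by (simp add: subset_prob_insert)
qed

text \<open>Applied to families of paths and to the pairs \<open>{x, s - x}\<close>; both may leave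
  part of the ground set \<open>V\<close> uncovered.\<close>

lemma subset_prob_blocks:
  assumes "finite I" "finite V" "disjoint_family_on B I" "\<And>i. i \<in> I \<Longrightarrow> B i \<subseteq> V"
  shows "subset_prob V (\<lambda>A. \<forall>i\<in>I. E i (A \<inter> B i)) = (\<Prod>i\<in>I. subset_prob (B i) (E i))"
  using assms
proof (induction I arbitrary: V rule: finite_induct)
  case empty
  then show ?case by simp
next
  case (insert i I)
  have disj: "B i \<inter> B j = {}" if "j \<in> I" for j
    using insert.prems(2) that insert.hyps(2) by (auto simp: disjoint_family_on_def)
  have fin: "finite (B i)" using insert.prems by (auto dest: finite_subset)
  have V: "V = B i \<union> (V - B i)" using insert.prems(3)[of i] by auto
  have "subset_prob V (\<lambda>A. \<forall>j\<in>insert i I. E j (A \<inter> B j)) =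
      subset_prob (B i \<union> (V - B i)) (\<lambda>A. E i (A \<inter> B i) \<and> (\<forall>j\<in>I. E j (A \<inter> (V - B i) \<inter> B j)))"
  proof -
    have "A \<inter> (V - B i) \<inter> B j = A \<inter> B j" if "j \<in> I" "A \<subseteq> V" for A j
      using disj[OF that(1)] insert.prems(3)[of j] that by blast
    then show ?thesis
      unfolding V[symmetric] by (intro subset_prob_cong) auto
  qed
  also have "\<dots> = subset_prob (B i) (E i) * subset_prob (V - B i) (\<lambda>A. \<forall>j\<in>I. E j (A \<inter> B j))"
    by (rule subset_prob_indep) (use fin insert.prems(1) in auto)
  also have "subset_prob (V - B i) (\<lambda>A. \<forall>j\<in>I. E j (A \<inter> B j)) = (\<Prod>j\<in>I. subset_prob (B j) (E j))"
  proof (rule insert.IH)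
    show "disjoint_family_on B I"
      using insert.prems(2) by (auto simp: disjoint_family_on_def)
    show "B j \<subseteq> V - B i" if "j \<in> I" for j
      using disj[OF that] insert.prems(3)[of j] that by blast
  qed (use insert.prems in auto)
  finally show ?case using insert.hyps by simp
qed

text \<open>Markov's inequality for \<open>\<theta> ^ card A\<close>, whose expectation is
  \<open>(1 - p + p * \<theta>) ^ card V\<close>: a Chernoff bound for the lower tail.\<close>

lemma subset_prob_card_le:
  assumes "finite V" "0 < \<theta>" "\<theta> \<le> 1"
  shows "subset_prob V (\<lambda>A. card A \<le> m) * \<theta> ^ m \<le> (1 - p + p * \<theta>) ^ card V"
  using assms(1)
proof (induction V arbitrary: m rule: finite_induct)
  case empty
  then show ?case using assms by (simp add: power_le_one)
next
  case (insert x V)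
  let ?P = "\<lambda>m. subset_prob V (\<lambda>A. card A \<le> m)" and ?c = "1 - p + p * \<theta>"
  have *: "subset_prob V (\<lambda>A. card (insert x A) \<le> m) * \<theta> ^ m \<le> \<theta> * ?c ^ card V"
  proof -
    have card: "card (insert x A) = Suc (card A)" if "A \<subseteq> V" for A
      using that insert.hyps by (subst card_insert_disjoint) (auto dest: finite_subset)
    show ?thesis
    proof (cases m)
      case 0
      then have "subset_prob V (\<lambda>A. card (insert x A) \<le> m) = subset_prob V (\<lambda>A. False)"
        by (intro subset_prob_cong) (simp add: card)
      then show ?thesis using assms p_pos p_less_1 by simp
    next
      case (Suc m')
      then have "subset_prob V (\<lambda>A. card (insert x A) \<le> m) = ?P m'"
        by (intro subset_prob_cong) (simp add: card)
      then show ?thesis using mult_left_mono[OF insert.IH[of m'], of \<theta>] assms Suc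
        by (simp add: mult_ac)
    qed
  qed
  have "subset_prob (insert x V) (\<lambda>A. card A \<le> m) * \<theta> ^ m =
      p * (subset_prob V (\<lambda>A. card (insert x A) \<le> m) * \<theta> ^ m) + (1 - p) * (?P m * \<theta> ^ m)"
    using insert.hyps by (simp add: subset_prob_insert algebra_simps)
  also have "\<dots> \<le> p * (\<theta> * ?c ^ card V) + (1 - p) * ?c ^ card V"
    by (intro add_mono mult_left_mono * insert.IH) (use p_pos p_less_1 in auto)
  also have "\<dots> = ?c ^ card (insert x V)"
    using insert.hyps by (simp add: algebra_simps)
  finally show ?case .
qed

text \<open>Each element of \<open>V\<close> contributes a factor \<open>p\<close> or
  \<open>1 - p\<close>. In the lower bound this prescribes boundedly many elements at bounded
  cost.\<close>

lemma subset_prob_singleton: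
  assumes "finite V" "B \<subseteq> V"
  shows "subset_prob V (\<lambda>A. A = B) \<ge> min p (1 - p) ^ card V"
  using assms
proof (induction V arbitrary: B rule: finite_induct)
  case empty
  then show ?case by simp
next
  case (insert x V)
  let ?m = "min p (1 - p)"
  have IH: "?m ^ card V \<le> subset_prob V (\<lambda>A. A = B - {x})"
    using insert.prems by (intro insert.IH) auto
  have "?m ^ card (insert x V) = ?m * ?m ^ card V" using insert.hyps by simp
  also have "\<dots> \<le> p * subset_prob V (\<lambda>A. insert x A = B) + (1 - p) * subset_prob V (\<lambda>A. A = B)"
  proof (cases "x \<in> B")
    case True
    have "subset_prob V (\<lambda>A. A = B - {x}) \<le> subset_prob V (\<lambda>A. insert x A = B)"
      by (rule subset_prob_mono) (use True in auto)
    then have "?m * ?m ^ card V \<le> p * subset_prob V (\<lambda>A. insert x A = B)"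
      using p_pos p_less_1 IH by (intro mult_mono) auto
    then show ?thesis using p_less_1 by (simp add: add_increasing2)
  next
    case False
    then have "?m * ?m ^ card V \<le> (1 - p) * subset_prob V (\<lambda>A. A = B)"
      using p_pos p_less_1 IH by (intro mult_mono) auto
    then show ?thesis using p_pos by (simp add: add_increasing)
  qed
  also have "\<dots> = subset_prob (insert x V) (\<lambda>A. A = B)"
    using insert.hyps by (rule subset_prob_insert[symmetric])
  finally show ?case .
qed

end

section \<open>Probabilities of missing sums\<close>

text \<open>
  The graph on \<open>{0..j}\<close> with edges \<open>a + b = j\<close> and \<open>a + b = j - d\<close> has maximal degree two. The list
  \<open>y, j - y, y - d, j - y + d, \<dots>\<close> is a path in it; stopping as soon as the entries of the form
  \<open>y - m * d\<close> drop to \<open>j / 2\<close> makes the paths starting at the \<open>d\<close> vertices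
  \<open>y \<in> {j - d<..j}\<close> disjoint, and together they miss at most the vertex \<open>j / 2\<close>.
\<close>

fun chain :: "nat \<Rightarrow> nat \<Rightarrow> nat \<Rightarrow> nat list" where
  "chain d j y = (if 0 < d \<and> j < 2 * y then y # (j - y) # chain d j (y - d) else [])"

declare chain.simps [simp del]

text \<open>Above \<open>j / 2\<close> a chain runs down the residue class of \<open>y\<close>
  modulo \<open>d\<close>, each entry being followed by its mirror image. Distinctness, disjointness
  and covering thus become questions about residues.\<close>

lemma set_chain:
  assumes "0 < d"
  shows "set (chain d j y) = (\<Union>z\<in>{z. j < 2 * z \<and> z \<le> y \<and> z mod d = y mod d}. {z, j - z})"
proof (induction y rule: less_induct)
  case (less y)
  let ?Z = "\<lambda>y. {z. j < 2 * z \<and> z \<le> y \<and> z mod d = y mod d}"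
  show ?case
  proof (cases "j < 2 * y")
    case False
    then show ?thesis by (subst chain.simps) auto
  next
    case True
    have "?Z y = insert y (?Z (y - d))"
    proof (cases "d \<le> y")
      case le: True
      \<comment> \<open>Distinct numbers in one residue class differ by at least \<open>d\<close>,
        so none lies strictly between \<open>y - d\<close> and \<open>y\<close>.\<close>
      have "z \<le> y - d \<longleftrightarrow> z < y" if "z mod d = y mod d" for z
      proof -
        have "d dvd y - z" if "z < y"
          using that \<open>z mod d = y mod d\<close> by (metis less_imp_le mod_eq_dvd_iff_nat)
        then have "d \<le> y - z" if "z < y" using that by (auto intro: dvd_imp_le)
        then show ?thesis using le assms by force
      qed
      moreover have "(y - d) mod d = y mod d" using le by (metis le_mod_geq)
      ultimately show ?thesis using True by auto
    next
      case False
      \<comment> \<open>Here \<open>y - d\<close> is truncated to \<open>0\<close> and the residue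
        class has no member below \<open>y\<close>, so only \<open>y\<close> itself remains.\<close>
      then show ?thesis using True by auto
    qed
    moreover have "y - d < y" using True assms by simp
    moreover have "set (chain d j y) = {y, j - y} \<union> set (chain d j (y - d))"
      using True assms by (subst chain.simps) auto
    ultimately show ?thesis using less.IH by simp
  qed
qed

lemma distinct_chain:
  assumes "0 < d" "y \<le> j"
  shows "distinct (chain d j y)"
  using assms(2)
proof (induction y rule: less_induct)
  case (less y)
  show ?case
  proof (cases "j < 2 * y")
    case False
    then show ?thesis by (subst chain.simps) auto
  next
    case True
    then have "distinct (chain d j (y - d))"
      using less assms by (intro less.IH) auto
    moreover have "y \<notin> set (chain d j (y - d))" "j - y \<notin> set (chain d j (y - d))"
      using True less.prems assms(1) by (auto simp: set_chain)
    ultimately show ?thesis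
      using True assms(1) less.prems by (subst chain.simps) auto
  qed
qed

text \<open>Neighbouring entries add up alternately to \<open>j\<close> and to \<open>j - d\<close>,
  as in \<open>y + (j - y)\<close> and \<open>(j - y) + (y - d)\<close>.\<close>

lemma chain_successively:
  assumes "0 < d" "y \<le> j" "d \<le> j" "j \<notin> A + A" "j - d \<notin> A + A"
  shows "successively (\<lambda>a b. \<not> (a \<in> A \<and> b \<in> A)) (chain d j y)"
  using assms(2)
proof (induction y rule: less_induct)
  case (less y)
  have no: "\<not> (a \<in> A \<and> b \<in> A)" if "a + b = j \<or> a + b = j - d" for a b
    using that assms(4,5) set_plus_intro[of a A b A] by auto
  show ?case
  proof (cases "j < 2 * y")
    case False
    then show ?thesis by (subst chain.simps) auto
  next
    case True
    then have IH: "successively (\<lambda>a b. \<not> (a \<in> A \<and> b \<in> A)) (chain d j (y - d))"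
      using less assms by (intro less.IH) auto
    have "\<not> (j - y \<in> A \<and> hd (chain d j (y - d)) \<in> A)" if "chain d j (y - d) \<noteq> []"
    proof (rule no)
      \<comment> \<open>A nonempty rest of the chain forces \<open>d < y\<close>, so
        \<open>y - d\<close> is not truncated.\<close>
      have *: "0 < d \<and> j < 2 * (y - d)" using that by (subst (asm) chain.simps) (auto split: if_splits)
      then have "hd (chain d j (y - d)) = y - d" by (subst chain.simps) simp
      moreover have "d < y" using * by linarith
      ultimately show "j - y + hd (chain d j (y - d)) = j \<or> j - y + hd (chain d j (y - d)) = j - d"
        using less.prems by simp
    qed
    then show ?thesis
      using True assms(1) IH no[of y "j - y"] less.prems
      by (subst chain.simps) (auto simp: successively_Cons)
  qed
qed

lemma chain_cover:
  assumes "i < j" "x \<le> j" "2 * x \<noteq> j"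
  shows "\<exists>y\<in>{i<..j}. x \<in> set (chain (j - i) j y)"
proof -
  define d where "d = j - i"
  \<comment> \<open>\<open>z\<close> is the member of the pair \<open>x\<close>,
    \<open>j - x\<close> above \<open>j / 2\<close>, and \<open>y\<close> is the largest number up
    to \<open>j\<close> congruent to \<open>z\<close> modulo \<open>d\<close>.\<close>
  define z where "z = (if j < 2 * x then x else j - x)"
  define y where "y = j - (j - z) mod d"
  have d: "0 < d" using assms by (simp add: d_def)
  have z: "j < 2 * z" "z \<le> j" "x = z \<or> x = j - z" using assms by (auto simp: z_def)
  have "(j - z) mod d < d" using d by simp
  moreover have "(j - z) mod d \<le> j - z" by simp
  moreover have "d \<le> j" by (simp add: d_def)
  ultimately have "i < y" "y \<le> j" "z \<le> y" using z assms(1) unfolding y_def d_def by linarith+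
  then have y: "y \<in> {i<..j}" "z \<le> y" by auto
  have "y = z + ((j - z) - (j - z) mod d)" using z \<open>(j - z) mod d \<le> j - z\<close> unfolding y_def by linarith
  also have "\<dots> = z + d * ((j - z) div d)" by (simp add: minus_mod_eq_mult_div)
  finally have "z mod d = y mod d" by simp
  then show ?thesis using y z d by (auto simp: set_chain d_def[symmetric] intro!: bexI[of _ y])
qed

text \<open>A common vertex determines \<open>z\<close>, hence the residue of both starting points,
  and \<open>{i<..j}\<close> contains each residue modulo \<open>j - i\<close> only once.\<close>

lemma chain_disjoint:
  assumes "i < j"
  shows "disjoint_family_on (\<lambda>y. set (chain (j - i) j y)) {i<..j}"
proof -
  have "y = y'" if "y \<in> {i<..j}" "y' \<in> {i<..j}" "x \<in> set (chain (j - i) j y)" "x \<in> set (chain (j - i) j y')"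
    for x y y'
  proof -
    have "0 < j - i" using assms by simp
    note * = that(3,4)[unfolded set_chain[OF this]]
    then obtain z z' where z: "j < 2 * z" "z \<le> y" "z mod (j - i) = y mod (j - i)" "x = z \<or> x = j - z"
      "j < 2 * z'" "z' \<le> y'" "z' mod (j - i) = y' mod (j - i)" "x = z' \<or> x = j - z'" by auto
    moreover have "y \<le> j" "y' \<le> j" using that by auto
    ultimately have "z = z'" by linarith
    then have m: "y mod (j - i) = y' mod (j - i)" using z by simp
    show ?thesis
    proof (rule ccontr)
      assume "y \<noteq> y'"
      then consider "y < y'" | "y' < y" by linarith
      then show False
      proof cases
        case 1
        then have "j - i dvd y' - y" using m by (metis less_imp_le mod_eq_dvd_iff_nat)
        then have "j - i \<le> y' - y" using 1 by (intro dvd_imp_le) auto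
        then show False using that 1 by auto
      next
        case 2
        then have "j - i dvd y - y'" using m by (metis less_imp_le mod_eq_dvd_iff_nat)
        then have "j - i \<le> y - y'" using 2 by (intro dvd_imp_le) auto
        then show False using that 2 by auto
      qed
    qed
  qed
  then show ?thesis by (auto simp: disjoint_family_on_def)
qed

context bernoulli
begin

section \<open>The decay rates \<open>lam\<close> and \<open>\<beta>\<close>\<close>

definition lam :: real where
  "lam = (1 - p + g p) / 2"

definition \<beta> :: real where
  "\<beta> = sqrt (1 - p\<^sup>2)"

lemma g_nonneg: "0 \<le> g p" and g_sq: "(g p)\<^sup>2 = (1 - p)\<^sup>2 + 4 * p * (1 - p)"
proof -
  have eq: "1 + 2 * p - 3 * p\<^sup>2 = (1 - p)\<^sup>2 + 4 * p * (1 - p)"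
    by (simp add: power2_eq_square algebra_simps)
  have "0 \<le> (1 - p)\<^sup>2" "0 \<le> 4 * p * (1 - p)" using p_pos p_less_1 by auto
  then have "0 \<le> (1 - p)\<^sup>2 + 4 * p * (1 - p)" by (rule add_nonneg_nonneg)
  then show "0 \<le> g p" "(g p)\<^sup>2 = (1 - p)\<^sup>2 + 4 * p * (1 - p)"
    unfolding g_def eq by (rule real_sqrt_ge_zero, rule real_sqrt_pow2)
qed

lemma lam_sq: "lam\<^sup>2 = (1 - p) * lam + p * (1 - p)"
  using g_sq by (simp add: lam_def power2_eq_square field_simps)

lemma lam_gt: "1 - p < lam"
proof -
  have "(1 - p)\<^sup>2 < (g p)\<^sup>2" using g_sq p_pos p_less_1 by simp
  then have "1 - p < g p" by (rule power2_less_imp_less[OF _ g_nonneg])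
  then show ?thesis by (simp add: lam_def)
qed

lemma lam_pos: "0 < lam"
  using lam_gt p_less_1 by simp

lemma lam_less_1: "lam < 1"
proof -
  have "(g p)\<^sup>2 < (1 + p)\<^sup>2"
    using g_sq mult_pos_pos[OF p_pos p_pos] by (simp add: power2_eq_square algebra_simps)
  then have "g p < 1 + p" by (rule power2_less_imp_less) (use p_pos in simp)
  then show ?thesis by (simp add: lam_def)
qed

text \<open>The quadratic equation together with \<open>lam + p > 1\<close>. It serves twice: an
  almost empty \<open>A\<close> below \<open>l / 2\<close> has to be less likely than
  \<open>lam ^ l\<close>, and the size condition has to yield \<open>lam ^ k\<close>.\<close>

lemma lam_sq_gt: "1 - p < lam\<^sup>2"
proof -
  have "(1 - p) * 1 < (1 - p) * (lam + p)"
    using lam_gt p_less_1 by (intro mult_strict_left_mono) auto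
  then show ?thesis by (simp add: lam_sq algebra_simps)
qed

lemma \<beta>_sq: "\<beta>\<^sup>2 = 1 - p\<^sup>2"
  using p_pos p_less_1 by (simp add: \<beta>_def power_le_one)

lemma \<beta>_pos: "0 < \<beta>"
  using p_pos p_less_1 by (simp add: \<beta>_def power_less_one_iff)

lemma \<beta>_less_1: "\<beta> < 1"
  using p_pos by (simp add: \<beta>_def)

text \<open>
  The avoidance probability \<open>a\<^sub>m\<close> of a path with \<open>m\<close> vertices satisfies
  \<open>a\<^sub>m\<^sub>+\<^sub>2 = (1 - p) * a\<^sub>m\<^sub>+\<^sub>1 + p * (1 - p) * a\<^sub>m\<close>, whose characteristic root is \<open>lam\<close>.
\<close>

lemma subset_prob_path:
  assumes "distinct vs"
  shows "lam * subset_prob (set vs) (\<lambda>A. successively (\<lambda>x y. \<not> (x \<in> A \<and> y \<in> A)) vs) \<le> lam ^ length vs"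
  using assms
proof (induction vs rule: induct_list012)
  case 1
  then show ?case using lam_less_1 by simp
next
  case (2 x)
  then show ?case using lam_pos by simp
next
  case (3 x y zs)
  let ?S = "\<lambda>vs A. successively (\<lambda>x y. \<not> (x \<in> A \<and> y \<in> A)) vs"
  let ?V = "set (y # zs)"
  \<comment> \<open>With \<open>x\<close> chosen, \<open>y\<close> must be absent, which decouples
    \<open>zs\<close> from the start of the path.\<close>
  have "subset_prob ?V (\<lambda>A. ?S (x # y # zs) (insert x A)) \<le> subset_prob (insert y (set zs)) (\<lambda>A. y \<notin> A \<and> ?S zs A)"
  proof (subst list.set(2)[symmetric], rule subset_prob_mono)
    fix A assume "?S (x # y # zs) (insert x A)"
    then have "y \<notin> A" "?S (y # zs) (insert x A)" by simp_all
    then have "?S zs (insert x A)" by (cases zs) simp_all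
    then have "?S zs A" by (rule successively_mono) auto
    with \<open>y \<notin> A\<close> show "y \<notin> A \<and> ?S zs A" by simp
  qed
  also have "\<dots> = (1 - p) * subset_prob (set zs) (?S zs)"
  proof (subst subset_prob_insert)
    have "subset_prob (set zs) (\<lambda>A. y \<notin> A \<and> ?S zs A) = subset_prob (set zs) (?S zs)"
      using 3 by (intro subset_prob_cong) auto
    then show "p * subset_prob (set zs) (\<lambda>A. y \<notin> insert y A \<and> ?S zs (insert y A)) +
      (1 - p) * subset_prob (set zs) (\<lambda>A. y \<notin> A \<and> ?S zs A) = (1 - p) * subset_prob (set zs) (?S zs)"
      by simp
  qed (use 3 in auto)
  finally have 1: "subset_prob ?V (\<lambda>A. ?S (x # y # zs) (insert x A)) \<le> (1 - p) * subset_prob (set zs) (?S zs)" .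
  have 2: "subset_prob ?V (?S (x # y # zs)) = subset_prob ?V (?S (y # zs))"
  proof (rule subset_prob_cong)
    fix A assume "A \<subseteq> set (y # zs)"
    then have "x \<notin> A" using 3 by auto
    then show "?S (x # y # zs) A \<longleftrightarrow> ?S (y # zs) A" by simp
  qed
  have "lam * subset_prob (set (x # y # zs)) (?S (x # y # zs)) =
      lam * (p * subset_prob ?V (\<lambda>A. ?S (x # y # zs) (insert x A)) + (1 - p) * subset_prob ?V (?S (x # y # zs)))"
    by (subst list.set(2), subst subset_prob_insert) (use 3 in auto)
  also have "\<dots> \<le> lam * (p * ((1 - p) * subset_prob (set zs) (?S zs)) + (1 - p) * subset_prob ?V (?S (y # zs)))"
    unfolding 2 by (intro mult_left_mono add_mono 1 order.refl) (use p_pos p_less_1 lam_pos in auto)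
  also have "\<dots> = p * (1 - p) * (lam * subset_prob (set zs) (?S zs)) + (1 - p) * (lam * subset_prob ?V (?S (y # zs)))"
    by (simp add: algebra_simps)
  also have "\<dots> \<le> p * (1 - p) * lam ^ length zs + (1 - p) * lam ^ length (y # zs)"
    by (intro add_mono mult_left_mono 3) (use 3 p_pos p_less_1 in auto)
  also have "\<dots> = lam ^ length zs * lam\<^sup>2" by (simp add: lam_sq algebra_simps)
  also have "\<dots> = lam ^ length (x # y # zs)" by (simp add: power2_eq_square)
  finally show ?case .
qed

section \<open>Bounds for one or two missing sums\<close>

text \<open>If both sums are missing, \<open>A\<close> is an independent set in each of
  \<open>j - i\<close> disjoint paths, and the path bounds multiply.\<close>

lemma subset_prob_two_missing:
  assumes "i < j" "j < h"
  shows "subset_prob {0..<h} (\<lambda>A. i \<notin> A + A \<and> j \<notin> A + A) \<le> lam ^ i"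
proof -
  define d where "d = j - i"
  let ?c = "chain d j"
  let ?S = "\<lambda>y A. successively (\<lambda>a b. \<not> (a \<in> A \<and> b \<in> A)) (?c y)"
  have d: "0 < d" "d \<le> j" "j - d = i" using assms by (auto simp: d_def)
  have dist: "distinct (?c y)" if "y \<in> {i<..j}" for y using that d by (intro distinct_chain) auto
  have sub: "set (?c y) \<subseteq> {0..<h}" if "y \<in> {i<..j}" for y
    using that assms by (auto simp: set_chain[OF d(1)])
  have disj: "disjoint_family_on (\<lambda>y. set (?c y)) {i<..j}"
    unfolding d_def using assms by (intro chain_disjoint)
  have "subset_prob {0..<h} (\<lambda>A. i \<notin> A + A \<and> j \<notin> A + A) \<le>
      subset_prob {0..<h} (\<lambda>A. \<forall>y\<in>{i<..j}. ?S y (A \<inter> set (?c y)))"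
  proof (rule subset_prob_mono, intro ballI)
    fix A y assume "i \<notin> A + A \<and> j \<notin> A + A" "y \<in> {i<..j}"
    then have "?S y A" using d by (intro chain_successively) auto
    then show "?S y (A \<inter> set (?c y))" by (rule successively_mono) auto
  qed
  also have "\<dots> = (\<Prod>y\<in>{i<..j}. subset_prob (set (?c y)) (?S y))"
    by (rule subset_prob_blocks) (use disj sub in auto)
  finally have "lam ^ d * subset_prob {0..<h} (\<lambda>A. i \<notin> A + A \<and> j \<notin> A + A) \<le>
      lam ^ d * (\<Prod>y\<in>{i<..j}. subset_prob (set (?c y)) (?S y))"
    using lam_pos by (intro mult_left_mono) auto
  also have "\<dots> = (\<Prod>y\<in>{i<..j}. lam * subset_prob (set (?c y)) (?S y))"
    by (simp add: prod.distrib d_def)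
  also have "\<dots> \<le> (\<Prod>y\<in>{i<..j}. lam ^ card (set (?c y)))"
  proof (rule prod_mono, intro conjI)
    fix y assume "y \<in> {i<..j}"
    then show "lam * subset_prob (set (?c y)) (?S y) \<le> lam ^ card (set (?c y))"
      using subset_prob_path[OF dist] dist by (simp add: distinct_card)
  qed (use lam_pos in auto)
  also have "\<dots> = lam ^ card (\<Union>y\<in>{i<..j}. set (?c y))"
    using disj by (subst card_UN_disjoint) (auto simp: disjoint_family_on_def power_sum)
  also have "\<dots> \<le> lam ^ j" \<comment> \<open>each of the \<open>d\<close> paths costs one factor, so \<open>lam ^ (j - d)\<close> remains\<close>
  proof (rule power_decreasing)
    \<comment> \<open>At most the vertex \<open>j / 2\<close> is uncovered, so the paths contain at
      least \<open>j\<close> of the \<open>j + 1\<close> vertices.\<close>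
    have "{0..j} \<subseteq> insert (j div 2) (\<Union>y\<in>{i<..j}. set (?c y))"
      using chain_cover[OF assms(1)] by (fastforce simp: d_def)
    then have "card {0..j} \<le> card (insert (j div 2) (\<Union>y\<in>{i<..j}. set (?c y)))"
      by (intro card_mono) auto
    also have "\<dots> \<le> Suc (card (\<Union>y\<in>{i<..j}. set (?c y)))" by (rule card_insert_le_m1) auto
    finally show "j \<le> card (\<Union>y\<in>{i<..j}. set (?c y))" by simp
  qed (use lam_pos lam_less_1 in auto)
  also have "\<dots> = lam ^ (d + i)" using d(2,3) by (metis le_add_diff_inverse)
  also have "\<dots> = lam ^ d * lam ^ i" by (rule power_add)
  finally show ?thesis using lam_pos by simp
qed

text \<open>The pairs \<open>{x, s - x}\<close> with \<open>2 * x < s\<close> are disjoint, hence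
  independent, and each lies in \<open>A\<close> with probability \<open>p\<^sup>2\<close>.\<close>

lemma subset_prob_missing_pairs:
  fixes s :: nat
  assumes "finite V" "R \<subseteq> {x \<in> V. s - x \<in> V \<and> 2 * x < s}"
  shows "subset_prob V (\<lambda>A. s \<notin> A + A) \<le> (1 - p\<^sup>2) ^ card R"
proof -
  have fin: "finite R" using assms by (auto dest: finite_subset)
  have "subset_prob V (\<lambda>A. s \<notin> A + A) \<le>
    subset_prob V (\<lambda>A. \<forall>x\<in>R. \<not> (x \<in> A \<inter> {x, s - x} \<and> s - x \<in> A \<inter> {x, s - x}))"
  proof (rule subset_prob_mono, intro ballI notI)
    fix A x assume "s \<notin> A + A" "x \<in> R" "x \<in> A \<inter> {x, s - x} \<and> s - x \<in> A \<inter> {x, s - x}"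
    then show False using assms set_plus_intro[of x A "s - x" A] by auto
  qed
  also have "\<dots> = (\<Prod>x\<in>R. subset_prob {x, s - x} (\<lambda>A. \<not> (x \<in> A \<and> s - x \<in> A)))"
  proof (rule subset_prob_blocks)
    have R: "2 * x < s" if "x \<in> R" for x using that assms by auto
    have "{x, s - x} \<inter> {y, s - y} = {}" if "x \<in> R" "y \<in> R" "x \<noteq> y" for x y
      using R[OF that(1)] R[OF that(2)] that(3) by auto
    then show "disjoint_family_on (\<lambda>x. {x, s - x}) R" by (auto simp: disjoint_family_on_def)
  qed (use assms fin in auto)
  also have "\<dots> = (\<Prod>x\<in>R. 1 - p\<^sup>2)"
  proof (rule prod.cong)
    fix x assume "x \<in> R"
    then have "x \<noteq> s - x" using assms by auto
    then show "subset_prob {x, s - x} (\<lambda>A. \<not> (x \<in> A \<and> s - x \<in> A)) = 1 - p\<^sup>2"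
      by (simp add: subset_prob_insert power2_eq_square algebra_simps)
  qed simp
  finally show ?thesis by simp
qed

text \<open>
  Excluding one element \<open>x\<close> destroys at most the two pairs starting with \<open>x\<close> or \<open>s - x\<close>, hence
  the factor \<open>\<beta> ^ 4\<close> for each element of \<open>X\<close>.
\<close>

lemma subset_prob_missing:
  assumes "finite X" "s \<le> 2 * N - 2"
  shows "subset_prob ({0..<N} - X) (\<lambda>A. s \<notin> A + A) \<le> \<beta> ^ min s (2 * N - 2 - s) / \<beta> ^ (4 * card X)"
proof -
  \<comment> \<open>The smaller members of the pairs in \<open>{0..<N}\<close> with sum
    \<open>s\<close>: the lower limit ensures \<open>s - x < N\<close> (truncated to
    \<open>0\<close> for \<open>s < N\<close>), the upper one \<open>2 * x < s\<close>.\<close>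
  define R0 where "R0 = {s + 1 - N..<(s + 1) div 2}"
  define R where "R = R0 - (X \<union> (\<lambda>x. s - x) ` X)"
  have "card (X \<union> (\<lambda>x. s - x) ` X) \<le> card X + card ((\<lambda>x. s - x) ` X)" by (rule card_Un_le)
  also have "\<dots> \<le> 2 * card X" using card_image_le[OF assms(1)] by simp
  finally have "card R0 - 2 * card X \<le> card R"
    using diff_card_le_card_Diff[of "X \<union> (\<lambda>x. s - x) ` X" R0] assms(1) unfolding R_def by auto
  moreover have "min s (2 * N - 2 - s) \<le> 2 * card R0"
    using assms(2) by (auto simp: R0_def)
  ultimately have le: "min s (2 * N - 2 - s) \<le> 2 * card R + 4 * card X" by linarith
  have "subset_prob ({0..<N} - X) (\<lambda>A. s \<notin> A + A) \<le> (1 - p\<^sup>2) ^ card R"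
  proof (rule subset_prob_missing_pairs)
    show "R \<subseteq> {x \<in> {0..<N} - X. s - x \<in> {0..<N} - X \<and> 2 * x < s}"
    proof
      fix x assume x: "x \<in> R"
      have "s - x \<notin> X"
      proof
        assume "s - x \<in> X"
        then have "s - (s - x) \<in> (\<lambda>x. s - x) ` X" by blast
        then show False using x by (auto simp: R_def R0_def)
      qed
      then show "x \<in> {x \<in> {0..<N} - X. s - x \<in> {0..<N} - X \<and> 2 * x < s}"
        using x assms(2) by (auto simp: R_def R0_def)
    qed
  qed simp
  also have "\<dots> = \<beta> ^ (2 * card R)" by (simp add: power_mult \<beta>_sq)
  also have "\<dots> = \<beta> ^ (2 * card R + 4 * card X) / \<beta> ^ (4 * card X)"
    using \<beta>_pos by (simp add: power_add)
  also have "\<dots> \<le> \<beta> ^ min s (2 * N - 2 - s) / \<beta> ^ (4 * card X)"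
    using \<beta>_pos \<beta>_less_1 le by (intro divide_right_mono power_decreasing) auto
  finally show ?thesis .
qed

end

section \<open>Missing sums at one end\<close>

lemma sum_power_le:
  fixes x :: real
  assumes "0 \<le> x" "x < 1"
  shows "(\<Sum>i\<in>{a..<b}. x ^ i) \<le> x ^ a / (1 - x)"
proof (cases "a \<le> b")
  case True
  then have "(\<Sum>i\<in>{a..<b}. x ^ i) * (1 - x) = x ^ a - x ^ b"
  proof (induction b rule: dec_induct)
    case (step n)
    then show ?case by (simp add: distrib_right right_diff_distrib)
  qed simp
  also have "\<dots> \<le> x ^ a" using assms by simp
  finally show ?thesis using assms by (simp add: pos_le_divide_eq)
next
  case False
  then show ?thesis using assms by simp
qed

lemma le_powr_interpolate:
  fixes x :: real
  assumes "0 \<le> x" "x \<le> a" "x \<le> b" "0 \<le> \<epsilon>" "\<epsilon> \<le> 1"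
  shows "x \<le> a powr (1 - \<epsilon>) * b powr \<epsilon>"
proof (cases "x = 0")
  case False
  then have "x = x powr (1 - \<epsilon>) * x powr \<epsilon>" using assms by (simp flip: powr_add)
  also have "\<dots> \<le> a powr (1 - \<epsilon>) * b powr \<epsilon>"
    using assms by (intro mult_mono powr_mono2) auto
  finally show ?thesis .
qed simp

text \<open>
  If the missing sums are dense in \<open>{0..<t}\<close>, then translating the small elements of \<open>A\<close> by one
  fixed small element shows that there are few of them.
\<close>

lemma few_summands:
  fixes A :: "nat set"
  assumes "l \<le> card ({0..<h} - (A + A))" "l \<le> t"
    and no2: "\<And>i j. t \<le> i \<Longrightarrow> i < j \<Longrightarrow> j < h \<Longrightarrow> i \<in> A + A \<or> j \<in> A + A"
  shows "card (A \<inter> {0..<l div 2}) \<le> t + 1 - l"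
proof (cases "A \<inter> {0..<l div 2} = {}")
  case False
  define M where "M = {0..<h} - (A + A)"
  obtain a0 where a0: "a0 \<in> A" "a0 < l div 2" using False by auto
  have "card (M \<inter> {t..}) \<le> Suc 0"
    using no2 unfolding M_def
    by (subst card_le_Suc0_iff_eq) (auto, metis linorder_neqE_nat)
  moreover have "card M = card (M \<inter> {0..<t}) + card (M \<inter> {t..})"
    unfolding M_def by (subst card_Un_disjoint[symmetric]) (auto intro!: arg_cong[where f = card])
  ultimately have 1: "l \<le> card (M \<inter> {0..<t}) + 1" using assms(1) by (simp add: M_def)
  \<comment> \<open>Adding \<open>a0\<close> keeps these elements below
    \<open>2 * (l div 2) \<le> t\<close>, and every image lies in \<open>A + A\<close>, so it is not
    missing.\<close>
  have "card (A \<inter> {0..<l div 2}) = card ((\<lambda>a. a + a0) ` (A \<inter> {0..<l div 2}))"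
    by (simp add: card_image)
  also have "\<dots> \<le> card ({0..<t} - M \<inter> {0..<t})"
    using a0 assms(2) by (intro card_mono) (auto simp: M_def)
  also have "\<dots> = t - card (M \<inter> {0..<t})"
    by (subst card_Diff_subset) auto
  finally show ?thesis using 1 by linarith
qed simp

context bernoulli
begin

text \<open>The bound \<open>lam ^ i\<close> does not decay in \<open>j\<close>. Interpolating it
  with the bound \<open>\<beta> ^ j\<close> for one missing sum makes the series over
  \<open>j\<close> converge, at the cost of a slightly larger base for \<open>i\<close>.\<close>

lemma subset_prob_two_missing_summable:
  assumes "i < j" "j < h" "0 \<le> \<epsilon>" "\<epsilon> \<le> 1"
  shows "subset_prob {0..<h} (\<lambda>A. i \<notin> A + A \<and> j \<notin> A + A) \<le> (lam powr (1 - \<epsilon>)) ^ i * (\<beta> powr \<epsilon>) ^ j"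
proof -
  have "subset_prob {0..<h} (\<lambda>A. i \<notin> A + A \<and> j \<notin> A + A) \<le> subset_prob {0..<h} (\<lambda>A. j \<notin> A + A)"
    by (rule subset_prob_mono) auto
  also have "\<dots> \<le> \<beta> ^ min j (2 * h - 2 - j)"
    using subset_prob_missing[of "{}" j h] assms by simp
  also have "min j (2 * h - 2 - j) = j" using assms by auto
  finally have "subset_prob {0..<h} (\<lambda>A. i \<notin> A + A \<and> j \<notin> A + A) \<le> (lam ^ i) powr (1 - \<epsilon>) * (\<beta> ^ j) powr \<epsilon>"
    using assms subset_prob_two_missing[OF assms(1,2)] by (intro le_powr_interpolate) auto
  also have "\<dots> = (lam powr (1 - \<epsilon>)) ^ i * (\<beta> powr \<epsilon>) ^ j"
    using lam_pos \<beta>_pos by (simp add: powr_power powr_powr mult.commute flip: powr_realpow)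
  finally show ?thesis .
qed

text \<open>
  The strict inequality \<open>\<rho> < lam\<close> absorbs the factor \<open>k + 1\<close> that arises when the missing sums
  are distributed over the two ends. It comes from \<open>t \<ge> (1 + \<delta>) * l\<close> in the case of two missing sums
  above \<open>t\<close>, and from \<open>1 - p < lam\<^sup>2\<close> in the case where \<open>A\<close> is almost empty below \<open>l / 2\<close>.
\<close>

lemma subset_prob_missing_tail:
  "\<exists>C \<rho>. 0 < C \<and> 0 < \<rho> \<and> \<rho> < lam \<and>
    (\<forall>(h :: nat) l. subset_prob {0..<h} (\<lambda>A. l \<le> card ({0..<h} - (A + A))) \<le> C * \<rho> ^ l)"
proof -
  \<comment> \<open>Chosen so that \<open>\<gamma> = 1 - p + p * \<theta>\<close> stays below
    \<open>1 - p + 2 * \<theta> = lam\<^sup>2\<close>.\<close>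
  define \<theta> where "\<theta> = (lam\<^sup>2 - (1 - p)) / 2"
  have lam_sq_less_1: "lam\<^sup>2 < 1" using lam_pos lam_less_1 by (simp add: power_less_one_iff)
  have \<theta>: "0 < \<theta>" "\<theta> < 1" using lam_sq_gt p_less_1 lam_sq_less_1 by (auto simp: \<theta>_def)
  define \<gamma> where "\<gamma> = 1 - p + p * \<theta>"
  have "p * \<theta> < 2 * \<theta>" using p_less_1 \<theta> by (intro mult_strict_right_mono) auto
  then have \<gamma>: "0 < \<gamma>" "\<gamma> < lam\<^sup>2" using p_pos p_less_1 \<theta> by (auto simp: \<gamma>_def \<theta>_def add_pos_pos)
  \<comment> \<open>The Chernoff bound involves only \<open>l div 2\<close> elements, so the rate
    per unit of \<open>l\<close> is the square root of \<open>\<gamma>\<close>.\<close>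
  define \<sigma> where "\<sigma> = sqrt \<gamma>"
  have \<sigma>: "0 < \<sigma>" "\<sigma> < lam" "\<sigma>\<^sup>2 = \<gamma>"
    using \<gamma> lam_pos real_sqrt_less_mono[OF \<gamma>(2)] by (auto simp: \<sigma>_def)
  \<comment> \<open>This value gives
    \<open>\<theta> powr (- \<delta>) = sqrt (lam / \<sigma>)\<close>, so allowing about
    \<open>\<delta> * l\<close> elements still keeps the rate below \<open>lam\<close>.\<close>
  define \<delta> where "\<delta> = ln (lam / \<sigma>) / (2 * - ln \<theta>)"
  have ln: "0 < ln (lam / \<sigma>)" "ln \<theta> < 0" using \<sigma> \<theta> by auto
  then have \<delta>: "0 < \<delta>" unfolding \<delta>_def by (intro divide_pos_pos) auto
  have "\<theta> powr (- \<delta>) = exp (ln (lam / \<sigma>) / 2)" using \<theta> ln by (simp add: powr_def \<delta>_def)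
  also have "\<dots> < exp (ln (lam / \<sigma>))" using ln by simp
  also have "\<dots> = lam / \<sigma>" using \<sigma> lam_pos by simp
  finally have \<rho>2: "\<sigma> * \<theta> powr (- \<delta>) < lam" using \<sigma> by (simp add: field_simps)
  \<comment> \<open>Small enough that the factor \<open>1 + \<delta>\<close> in the threshold
    \<open>t\<close> outweighs the interpolation loss, leaving the exponent
    \<open>1 + \<delta> / 2\<close>.\<close>
  define \<epsilon> where "\<epsilon> = \<delta> / (2 * (1 + \<delta>))"
  have \<epsilon>: "0 < \<epsilon>" "\<epsilon> < 1" "(1 - \<epsilon>) * (1 + \<delta>) = 1 + \<delta> / 2" using \<delta> by (auto simp: \<epsilon>_def field_simps)
  define \<mu> \<nu> where "\<mu> = lam powr (1 - \<epsilon>)" and "\<nu> = \<beta> powr \<epsilon>"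
  have \<mu>: "0 < \<mu>" "\<mu> < 1" using lam_pos lam_less_1 \<epsilon> by (auto simp: \<mu>_def powr01_less_one)
  have \<nu>: "0 < \<nu>" "\<nu> < 1" using \<beta>_pos \<beta>_less_1 \<epsilon> by (auto simp: \<nu>_def powr01_less_one)
  define \<rho> where "\<rho> = max (lam powr (1 + \<delta> / 2)) (\<sigma> * \<theta> powr (- \<delta>))"
  have "lam powr (1 + \<delta> / 2) < lam powr 1" using lam_pos lam_less_1 \<delta> by (intro powr_less_mono') auto
  then have \<rho>: "0 < \<rho>" "\<rho> < lam" using \<rho>2 lam_pos by (auto simp: \<rho>_def less_max_iff_disj)
  \<comment> \<open>The first term comes from the two geometric series. The second collects the
    rounding losses: \<open>1 / \<sigma>\<close> for \<open>l div 2\<close>, and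
    \<open>1 / \<theta>\<^sup>2\<close> for \<open>m \<le> \<delta> * l + 2\<close>.\<close>
  define C where "C = 1 / ((1 - \<mu>) * (1 - \<nu>)) + 1 / (\<sigma> * \<theta>\<^sup>2)"
  have C: "0 < C" using \<mu> \<nu> \<sigma> \<theta> by (auto simp: C_def intro!: add_pos_pos)
  have "subset_prob {0..<h} (\<lambda>A. l \<le> card ({0..<h} - (A + A))) \<le> C * \<rho> ^ l" for h l :: nat
  proof (cases "l \<le> h")
    case False
    have "\<not> l \<le> card ({0..<h} - (A + A))" for A
      using False card_mono[of "{0..<h}" "{0..<h} - (A + A)"] by simp
    then show ?thesis using C \<rho> by simp
  next
    case True
    define t where "t = nat \<lceil>(1 + \<delta>) * real l\<rceil>"
    have "real t = of_int \<lceil>(1 + \<delta>) * real l\<rceil>" using \<delta> by (simp add: t_def)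
    then have t: "(1 + \<delta>) * real l \<le> real t" "real t \<le> (1 + \<delta>) * real l + 1"
      by linarith+
    have "real l \<le> (1 + \<delta>) * real l" using \<delta> by (simp add: algebra_simps)
    then have lt: "l \<le> t" using t by linarith
    let ?P1 = "subset_prob {0..<h} (\<lambda>A. \<exists>i\<in>{t..<h}. \<exists>j\<in>{0..<h}. i < j \<and> i \<notin> A + A \<and> j \<notin> A + A)"
    let ?P2 = "subset_prob {0..<h} (\<lambda>A. card (A \<inter> {0..<l div 2}) \<le> t + 1 - l)"
    have "subset_prob {0..<h} (\<lambda>A. l \<le> card ({0..<h} - (A + A))) \<le>
      subset_prob {0..<h} (\<lambda>A. (\<exists>i\<in>{t..<h}. \<exists>j\<in>{0..<h}. i < j \<and> i \<notin> A + A \<and> j \<notin> A + A) \<or>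
        card (A \<inter> {0..<l div 2}) \<le> t + 1 - l)"
    proof (rule subset_prob_mono)
      fix A :: "nat set" assume "l \<le> card ({0..<h} - (A + A))"
      then show "(\<exists>i\<in>{t..<h}. \<exists>j\<in>{0..<h}. i < j \<and> i \<notin> A + A \<and> j \<notin> A + A) \<or>
          card (A \<inter> {0..<l div 2}) \<le> t + 1 - l"
        using few_summands[of l h A t] lt by fastforce
    qed
    also have "\<dots> \<le> ?P1 + ?P2" by (rule subset_prob_disj_le)
    also have "?P1 \<le> 1 / ((1 - \<mu>) * (1 - \<nu>)) * \<rho> ^ l"
    proof -
      have "?P1 \<le> (\<Sum>i\<in>{t..<h}. \<Sum>j\<in>{0..<h}. subset_prob {0..<h} (\<lambda>A. i < j \<and> i \<notin> A + A \<and> j \<notin> A + A))"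
        by (rule order.trans[OF subset_prob_union_le[OF finite_atLeastLessThan]], rule sum_mono,
            rule subset_prob_union_le) simp
      also have "\<dots> \<le> (\<Sum>i\<in>{t..<h}. \<Sum>j\<in>{0..<h}. \<mu> ^ i * \<nu> ^ j)"
      proof (intro sum_mono)
        fix i j assume "j \<in> {0..<h}"
        then show "subset_prob {0..<h} (\<lambda>A. i < j \<and> i \<notin> A + A \<and> j \<notin> A + A) \<le> \<mu> ^ i * \<nu> ^ j"
          using subset_prob_two_missing_summable[of i j h \<epsilon>] \<epsilon> \<mu> \<nu>
          by (cases "i < j") (auto simp: \<mu>_def \<nu>_def)
      qed
      also have "\<dots> = (\<Sum>i\<in>{t..<h}. \<mu> ^ i) * (\<Sum>j\<in>{0..<h}. \<nu> ^ j)"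
        by (simp add: sum_product)
      also have "\<dots> \<le> \<mu> ^ t / (1 - \<mu>) * (\<nu> ^ 0 / (1 - \<nu>))"
        using \<mu> \<nu> by (intro mult_mono sum_power_le sum_nonneg) auto
      also have "\<dots> = 1 / ((1 - \<mu>) * (1 - \<nu>)) * \<mu> ^ t" by simp
      also have "\<dots> \<le> 1 / ((1 - \<mu>) * (1 - \<nu>)) * \<rho> ^ l"
      proof (rule mult_left_mono)
        have "\<mu> ^ t = lam powr ((1 - \<epsilon>) * real t)" using lam_pos by (simp add: \<mu>_def powr_power mult.commute)
        also have "\<dots> \<le> lam powr ((1 - \<epsilon>) * ((1 + \<delta>) * real l))"
          using lam_pos lam_less_1 t \<epsilon> by (intro powr_mono') auto
        also have "(1 - \<epsilon>) * ((1 + \<delta>) * real l) = (1 + \<delta> / 2) * real l"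
          using \<epsilon>(3) by (simp flip: mult.assoc)
        also have "lam powr \<dots> = (lam powr (1 + \<delta> / 2)) ^ l" using lam_pos by (simp add: powr_power mult.commute)
        also have "\<dots> \<le> \<rho> ^ l" by (intro power_mono) (auto simp: \<rho>_def)
        finally show "\<mu> ^ t \<le> \<rho> ^ l" .
      qed (use \<mu> \<nu> in auto)
      finally show ?thesis .
    qed
    also have "?P2 \<le> 1 / (\<sigma> * \<theta>\<^sup>2) * \<rho> ^ l"
    proof -
      define m where "m = t + 1 - l"
      have "?P2 = subset_prob {0..<l div 2} (\<lambda>A. card A \<le> m)"
        unfolding m_def using True by (intro subset_prob_Int[of "{0..<h}" "{0..<l div 2}" "\<lambda>A. card A \<le> t + 1 - l"]) auto
      also have "\<dots> \<le> \<gamma> ^ (l div 2) * (1 / \<theta> ^ m)"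
        using subset_prob_card_le[of "{0..<l div 2}" \<theta> m] \<theta> by (simp add: \<gamma>_def field_simps)
      also have "\<dots> \<le> (\<sigma> ^ l / \<sigma>) * ((\<theta> powr (- \<delta>)) ^ l / \<theta>\<^sup>2)"
      proof (rule mult_mono)
        have "\<sigma> * \<gamma> ^ (l div 2) = \<sigma> ^ Suc (2 * (l div 2))" by (simp add: power_mult \<sigma>)
        also have "\<dots> \<le> \<sigma> ^ l" using \<sigma> lam_less_1 by (intro power_decreasing) auto
        finally show "\<gamma> ^ (l div 2) \<le> \<sigma> ^ l / \<sigma>" using \<sigma> by (simp add: field_simps)
      next
        have "real m \<le> \<delta> * real l + 2" using t lt by (simp add: m_def algebra_simps of_nat_diff)
        then have "\<theta> powr (\<delta> * real l + 2) \<le> \<theta> powr real m" using \<theta> by (intro powr_mono') auto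
        also have "\<dots> = \<theta> ^ m" using \<theta> by (simp add: powr_realpow)
        finally have "1 / \<theta> ^ m \<le> 1 / \<theta> powr (\<delta> * real l + 2)" using \<theta> by (intro divide_left_mono) auto
        also have "\<theta> powr (\<delta> * real l + 2) = (\<theta> powr \<delta>) ^ l * \<theta>\<^sup>2"
          using \<theta> by (simp add: powr_add powr_power mult.commute)
        also have "1 / \<dots> = (\<theta> powr (- \<delta>)) ^ l / \<theta>\<^sup>2"
          by (simp add: powr_minus power_inverse divide_inverse)
        finally show "1 / \<theta> ^ m \<le> (\<theta> powr (- \<delta>)) ^ l / \<theta>\<^sup>2" .
      qed (use \<sigma> \<theta> in auto)
      also have "\<dots> = 1 / (\<sigma> * \<theta>\<^sup>2) * (\<sigma> * \<theta> powr (- \<delta>)) ^ l"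
        by (simp add: power_mult_distrib)
      also have "\<dots> \<le> 1 / (\<sigma> * \<theta>\<^sup>2) * \<rho> ^ l"
        using \<sigma> \<theta> by (intro mult_left_mono power_mono) (auto simp: \<rho>_def)
      finally show ?thesis .
    qed
    finally show ?thesis by (simp add: C_def algebra_simps)
  qed
  then show ?thesis using C \<rho> by blast
qed

text \<open>Passes from the integer count to the set of missing sums; \<open>0 < n\<close> keeps the
  natural number \<open>2 * n - 1\<close> from being truncated.\<close>

lemma missing_sums_prob_eq:
  assumes "0 < n"
  shows "missing_sums_prob n p k = subset_prob {0..<n} (\<lambda>A. card ({0..<2 * n - 1} - (A + A)) = k)"
proof -
  have "missing_sums_prob n p k = subset_prob {0..<n} (\<lambda>A. 2 * int n - 1 - int (card (A + A)) = int k)"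
    by (simp add: missing_sums_prob_def random_subset_def bernoulli_subset_def)
  also have "\<dots> = subset_prob {0..<n} (\<lambda>A. card ({0..<2 * n - 1} - (A + A)) = k)"
  proof (rule subset_prob_cong)
    fix A assume A: "A \<subseteq> {0..<n}"
    have sub: "A + A \<subseteq> {0..<2 * n - 1}" proof
      fix s assume "s \<in> A + A"
      then obtain a b where "s = a + b" "a \<in> A" "b \<in> A" by (rule set_plus_elim)
      moreover from this A have "a < n" "b < n" by auto
      ultimately show "s \<in> {0..<2 * n - 1}" by simp
    qed
    then have "finite (A + A)" by (rule finite_subset) simp
    then have "card ({0..<2 * n - 1} - (A + A)) = 2 * n - 1 - card (A + A)"
      using sub by (simp add: card_Diff_subset)
    moreover have "card (A + A) \<le> 2 * n - 1" using card_mono[OF _ sub] by simp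
    ultimately show "2 * int n - 1 - int (card (A + A)) = int k \<longleftrightarrow> card ({0..<2 * n - 1} - (A + A)) = k"
      using assms by auto
  qed
  finally show ?thesis .
qed

end

section \<open>The upper bound\<close>

lemma Int_initial_plus:
  fixes A :: "nat set"
  shows "{0..<h} - ((A \<inter> {0..<h}) + (A \<inter> {0..<h})) = {0..<h} - (A + A)"
proof -
  have "s \<in> (A \<inter> {0..<h}) + (A \<inter> {0..<h})" if "s \<in> A + A" "s < h" for s
    using that by (elim set_plus_elim) (auto intro!: set_plus_intro)
  then show ?thesis using set_plus_mono2[of "A \<inter> {0..<h}" A "A \<inter> {0..<h}" A] by auto
qed

text \<open>A sum of at least \<open>2 * n - 1 - h\<close> with one summand at most
  \<open>n - 1\<close> has the other at least \<open>n - h\<close>, so the upper end depends only on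
  the last \<open>h\<close> positions.\<close>

lemma Int_final_plus:
  fixes A :: "nat set"
  assumes "A \<subseteq> {0..<n}" "h \<le> n"
  shows "{2 * n - 1 - h..<2 * n - 1} - ((A \<inter> {n - h..<n}) + (A \<inter> {n - h..<n})) =
    {2 * n - 1 - h..<2 * n - 1} - (A + A)"
proof -
  have "s \<in> (A \<inter> {n - h..<n}) + (A \<inter> {n - h..<n})" if "s \<in> A + A" "2 * n - 1 - h \<le> s" for s
  proof -
    obtain a b where ab: "s = a + b" "a \<in> A" "b \<in> A" using \<open>s \<in> A + A\<close> by (rule set_plus_elim)
    then have "a < n" "b < n" using assms by auto
    then have "n - h \<le> a" "n - h \<le> b" using that ab by linarith+
    then show ?thesis using ab \<open>a < n\<close> \<open>b < n\<close> by (auto intro!: set_plus_intro)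
  qed
  then show ?thesis using set_plus_mono2[of "A \<inter> {n - h..<n}" A "A \<inter> {n - h..<n}" A] by auto
qed

text \<open>Reflecting \<open>x\<close> to \<open>n - 1 - x\<close> sends a sum \<open>s\<close> to
  \<open>2 * n - 2 - s\<close>; this transfers bounds from the lower end to the upper end.\<close>

lemma card_reflect_missing:
  fixes A :: "nat set"
  assumes "A \<subseteq> {0..<h}" "h \<le> n"
  shows "card ({2 * n - 1 - h..<2 * n - 1} - ((\<lambda>x. n - 1 - x) ` A + (\<lambda>x. n - 1 - x) ` A)) =
    card ({0..<h} - (A + A))"
proof -
  let ?f = "\<lambda>x. n - 1 - x" and ?r = "\<lambda>s. 2 * n - 2 - s"
  have mem: "?r s \<in> ?f ` A + ?f ` A \<longleftrightarrow> s \<in> A + A" if "s < h" for s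
  proof
    assume "?r s \<in> ?f ` A + ?f ` A"
    then obtain a b where ab: "?r s = ?f a + ?f b" "a \<in> A" "b \<in> A" by (auto elim!: set_plus_elim)
    then have "a < n" "b < n" using assms by auto
    then have "s = a + b" using ab that assms(2) by linarith
    then show "s \<in> A + A" using ab by (auto intro: set_plus_intro)
  next
    assume "s \<in> A + A"
    then obtain a b where ab: "s = a + b" "a \<in> A" "b \<in> A" by (rule set_plus_elim)
    then have "a < n" "b < n" using assms by auto
    then have "?r s = ?f a + ?f b" using ab by linarith
    then show "?r s \<in> ?f ` A + ?f ` A" using ab by (auto intro: set_plus_intro)
  qed
  have "{2 * n - 1 - h..<2 * n - 1} - (?f ` A + ?f ` A) = ?r ` ({0..<h} - (A + A))"
  proof (intro equalityI subsetI)
    fix x assume x: "x \<in> {2 * n - 1 - h..<2 * n - 1} - (?f ` A + ?f ` A)"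
    then have "x = ?r (?r x)" "?r x < h" using assms by auto
    moreover have "?r x \<notin> A + A" using mem[of "?r x"] x calculation by auto
    ultimately show "x \<in> ?r ` ({0..<h} - (A + A))" by auto
  qed (use mem assms in auto)
  also have "card \<dots> = card ({0..<h} - (A + A))"
    by (rule card_image) (use assms in \<open>auto simp: inj_on_def\<close>)
  finally show ?thesis .
qed

lemma sum_power_min_le:
  fixes x :: real
  assumes "0 \<le> x" "x < 1"
  shows "(\<Sum>s\<in>{h..<2 * n - 1 - h}. x ^ min s (2 * n - 2 - s)) \<le> 2 * x ^ h / (1 - x)"
proof -
  let ?M = "{h..<2 * n - 1 - h}"
  have "(\<Sum>s\<in>?M. x ^ min s (2 * n - 2 - s)) \<le> (\<Sum>s\<in>?M. x ^ s + x ^ (2 * n - 2 - s))"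
    using assms by (intro sum_mono) (simp add: min_def)
  also have "\<dots> = 2 * (\<Sum>s\<in>?M. x ^ s)"
  proof -
    have "(\<Sum>s\<in>?M. x ^ (2 * n - 2 - s)) = (\<Sum>s\<in>?M. x ^ s)"
      by (rule sum.reindex_bij_witness[of _ "\<lambda>s. 2 * n - 2 - s" "\<lambda>s. 2 * n - 2 - s"]) auto
    then show ?thesis by (simp add: sum.distrib)
  qed
  also have "\<dots> \<le> 2 * (x ^ h / (1 - x))"
    using assms by (intro mult_left_mono sum_power_le) auto
  finally show ?thesis by simp
qed

context bernoulli
begin

text \<open>A union bound handles the middle sums. Otherwise \<open>l\<close> missing sums lie at
  the lower end and \<open>k - l\<close> at the upper end, and \<open>2 * h \<le> n\<close> makes
  the two ends independent.\<close>

lemma missing_sums_fringes: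
  fixes n k :: nat
  assumes h: "2 * h \<le> n" "0 < n"
  shows "missing_sums_prob n p k \<le> 2 * \<beta> ^ h / (1 - \<beta>) +
    (\<Sum>l\<in>{0..k}. subset_prob {0..<h} (\<lambda>A. l \<le> card ({0..<h} - (A + A))) *
      subset_prob {0..<h} (\<lambda>A. k - l \<le> card ({0..<h} - (A + A))))"
proof -
  let ?I = "{0..<h}" and ?J = "{n - h..<n}" and ?M = "{h..<2 * n - 1 - h}" and ?T = "{2 * n - 1 - h..<2 * n - 1}"
  define L where "L = (\<lambda>l (A :: nat set). l \<le> card (?I - (A + A)))"
  define R where "R = (\<lambda>l (A :: nat set). l \<le> card (?T - (A + A)))"
  have "missing_sums_prob n p k = subset_prob {0..<n} (\<lambda>A. card ({0..<2 * n - 1} - (A + A)) = k)"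
    using h by (intro missing_sums_prob_eq)
  also have "\<dots> \<le> subset_prob {0..<n} (\<lambda>A. (\<exists>s\<in>?M. s \<notin> A + A) \<or>
      (\<exists>l\<in>{0..k}. L l (A \<inter> ?I) \<and> R (k - l) (A \<inter> ?J)))"
  proof (rule subset_prob_mono)
    fix A assume A: "A \<subseteq> {0..<n}" and k: "card ({0..<2 * n - 1} - (A + A)) = k"
    show "(\<exists>s\<in>?M. s \<notin> A + A) \<or> (\<exists>l\<in>{0..k}. L l (A \<inter> ?I) \<and> R (k - l) (A \<inter> ?J))"
    proof (cases "\<exists>s\<in>?M. s \<notin> A + A")
      case False
      have "{0..<2 * n - 1} = ?I \<union> ?M \<union> ?T" using h by auto
      then have "{0..<2 * n - 1} - (A + A) = (?I - (A + A)) \<union> (?T - (A + A))"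
        using False by auto
      also have "card \<dots> = card (?I - (A + A)) + card (?T - (A + A))"
        by (rule card_Un_disjoint) (use h in auto)
      finally have "k = card (?I - (A + A)) + card (?T - (A + A))" using k by simp
      then have "L (card (?I - (A + A))) (A \<inter> ?I)" "R (k - card (?I - (A + A))) (A \<inter> ?J)"
        "card (?I - (A + A)) \<in> {0..k}"
        unfolding L_def R_def using Int_final_plus[OF A, of h] h by (auto simp: Int_initial_plus)
      then show ?thesis by blast
    qed simp
  qed
  also have "\<dots> \<le> (\<Sum>s\<in>?M. subset_prob {0..<n} (\<lambda>A. s \<notin> A + A)) +
      (\<Sum>l\<in>{0..k}. subset_prob {0..<n} (\<lambda>A. L l (A \<inter> ?I) \<and> R (k - l) (A \<inter> ?J)))"
    by (rule order.trans[OF subset_prob_disj_le add_mono]; rule subset_prob_union_le) simp_all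
  also have "(\<Sum>s\<in>?M. subset_prob {0..<n} (\<lambda>A. s \<notin> A + A)) \<le> 2 * \<beta> ^ h / (1 - \<beta>)"
  proof -
    have "(\<Sum>s\<in>?M. subset_prob {0..<n} (\<lambda>A. s \<notin> A + A)) \<le> (\<Sum>s\<in>?M. \<beta> ^ min s (2 * n - 2 - s))"
    proof (rule sum_mono)
      fix s assume "s \<in> ?M"
      then show "subset_prob {0..<n} (\<lambda>A. s \<notin> A + A) \<le> \<beta> ^ min s (2 * n - 2 - s)"
        using subset_prob_missing[of "{}" s n] by auto
    qed
    also have "\<dots> \<le> 2 * \<beta> ^ h / (1 - \<beta>)" using \<beta>_pos \<beta>_less_1 by (intro sum_power_min_le) auto
    finally show ?thesis .
  qed
  also have "(\<Sum>l\<in>{0..k}. subset_prob {0..<n} (\<lambda>A. L l (A \<inter> ?I) \<and> R (k - l) (A \<inter> ?J))) =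
      (\<Sum>l\<in>{0..k}. subset_prob ?I (L l) * subset_prob ?I (L (k - l)))"
  proof (rule sum.cong)
    fix l
    have "subset_prob {0..<n} (\<lambda>A. L l (A \<inter> ?I) \<and> R (k - l) (A \<inter> ?J)) =
        subset_prob (?I \<union> ?J) (\<lambda>A. L l (A \<inter> ?I) \<and> R (k - l) (A \<inter> ?J))"
    proof -
      have "subset_prob {0..<n} (\<lambda>A. (L l (A \<inter> (?I \<union> ?J) \<inter> ?I) \<and> R (k - l) (A \<inter> (?I \<union> ?J) \<inter> ?J))) =
          subset_prob (?I \<union> ?J) (\<lambda>A. L l (A \<inter> ?I) \<and> R (k - l) (A \<inter> ?J))"
        by (rule subset_prob_Int) (use h in auto)
      then show ?thesis by (simp add: Int_assoc Int_absorb1 Int_absorb2)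
    qed
    also have "\<dots> = subset_prob ?I (L l) * subset_prob ?J (R (k - l))"
      by (rule subset_prob_indep) (use h in auto)
    also have "subset_prob ?J (R (k - l)) = subset_prob ?I (L (k - l))"
    proof -
      have J: "?J = (\<lambda>x. n - 1 - x) ` ?I"
      proof (intro equalityI subsetI)
        fix x assume "x \<in> ?J"
        then have "x = n - 1 - (n - 1 - x)" "n - 1 - x \<in> ?I" by auto
        then show "x \<in> (\<lambda>x. n - 1 - x) ` ?I" by blast
      qed (use h in auto)
      have "subset_prob ?J (R (k - l)) = subset_prob ?I (\<lambda>A. R (k - l) ((\<lambda>x. n - 1 - x) ` A))"
        unfolding J by (rule subset_prob_image) (use h in \<open>auto simp: inj_on_def\<close>)
      also have "\<dots> = subset_prob ?I (L (k - l))"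
        unfolding R_def L_def by (rule subset_prob_cong, subst card_reflect_missing) (use h in auto)
      finally show ?thesis .
    qed
    finally show "subset_prob {0..<n} (\<lambda>A. L l (A \<inter> ?I) \<and> R (k - l) (A \<inter> ?J)) =
      subset_prob ?I (L l) * subset_prob ?I (L (k - l))" .
  qed simp
  finally show ?thesis by (simp add: L_def)
qed

lemma ln_one_minus_sq_neg: "ln (1 - p\<^sup>2) < 0"
  using p_pos p_less_1 by (simp add: power_less_one_iff)

text \<open>The size condition on \<open>n\<close> says exactly that \<open>\<beta> powr n < (1 - p) powr k\<close>.\<close>

lemma \<beta>_powr_le:
  assumes "real n > 2 * (ln (1 - p) / ln (1 - p\<^sup>2)) * real k"
  shows "\<beta> powr (real n / 2) \<le> lam ^ k"
proof -
  have "1 - p\<^sup>2 > 0" using p_pos p_less_1 by (simp add: power_less_one_iff)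
  have "real n * ln (1 - p\<^sup>2) < 2 * real k * ln (1 - p)"
    using assms ln_one_minus_sq_neg by (simp add: field_simps)
  moreover have "ln \<beta> = ln (1 - p\<^sup>2) / 2"
    using \<open>1 - p\<^sup>2 > 0\<close> by (simp add: \<beta>_def ln_sqrt)
  ultimately have "real n / 2 * ln \<beta> \<le> real k / 2 * ln (1 - p)" by (simp only: times_divide_eq_right)
  also have "\<dots> \<le> real k / 2 * ln (lam\<^sup>2)"
    using lam_sq_gt p_less_1 by (intro mult_left_mono ln_mono) auto
  also have "\<dots> = real k * ln lam" using lam_pos by (simp add: ln_realpow)
  finally have "exp (real n / 2 * ln \<beta>) \<le> exp (real k * ln lam)" by simp
  then show ?thesis using \<beta>_pos lam_pos by (simp add: powr_def exp_of_nat_mult)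
qed

lemma missing_sums_prob_upper:
  "\<exists>c>0. \<forall>k n. real n > 2 * (ln (1 - p) / ln (1 - p\<^sup>2)) * real k \<longrightarrow>
    missing_sums_prob n p k \<le> c * lam ^ k"
proof -
  obtain C \<rho> where C: "0 < C" and \<rho>: "0 < \<rho>" "\<rho> < lam"
    and tail: "\<And>(h :: nat) l. subset_prob {0..<h} (\<lambda>A. l \<le> card ({0..<h} - (A + A))) \<le> C * \<rho> ^ l"
    using subset_prob_missing_tail by blast
  \<comment> \<open>\<open>sqrt \<beta>\<close> pays for rounding in \<open>h = n div 2\<close>; the
    second summand comes from distributing \<open>k\<close> over the two ends.\<close>
  define c where "c = 2 / ((1 - \<beta>) * sqrt \<beta>) + C\<^sup>2 / (1 - \<rho> / lam)"
  have r: "0 < \<rho> / lam" "\<rho> / lam < 1" using \<rho> lam_pos by auto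
  have "0 < c" using \<beta>_pos \<beta>_less_1 C r by (auto simp: c_def intro!: add_pos_pos divide_pos_pos)
  moreover have "missing_sums_prob n p k \<le> c * lam ^ k"
    if n: "real n > 2 * (ln (1 - p) / ln (1 - p\<^sup>2)) * real k" for n k
  proof -
    have "0 \<le> 2 * (ln (1 - p) / ln (1 - p\<^sup>2)) * real k"
      using ln_one_minus_sq_neg p_pos p_less_1 by (intro mult_nonneg_nonneg divide_nonpos_neg) auto
    then have "0 < n" using n by linarith
    define h where "h = n div 2"
    have "missing_sums_prob n p k \<le> 2 * \<beta> ^ h / (1 - \<beta>) +
      (\<Sum>l\<in>{0..k}. subset_prob {0..<h} (\<lambda>A. l \<le> card ({0..<h} - (A + A))) *
        subset_prob {0..<h} (\<lambda>A. k - l \<le> card ({0..<h} - (A + A))))"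
      using \<open>0 < n\<close> by (intro missing_sums_fringes) (auto simp: h_def)
    also have "(\<Sum>l\<in>{0..k}. subset_prob {0..<h} (\<lambda>A. l \<le> card ({0..<h} - (A + A))) *
        subset_prob {0..<h} (\<lambda>A. k - l \<le> card ({0..<h} - (A + A)))) \<le>
        (\<Sum>l\<in>{0..k}. (C * \<rho> ^ l) * (C * \<rho> ^ (k - l)))"
      using C \<rho> by (intro sum_mono mult_mono tail) auto
    also have "\<dots> = C\<^sup>2 * lam ^ k * (\<Sum>l\<in>{0..k}. (\<rho> / lam) ^ k)"
    proof -
      have "(C * \<rho> ^ l) * (C * \<rho> ^ (k - l)) = C\<^sup>2 * lam ^ k * (\<rho> / lam) ^ k" if "l \<in> {0..k}" for l
        using that lam_pos by (simp add: power2_eq_square power_divide flip: power_add)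
      then show ?thesis by (simp add: sum_distrib_left)
    qed
    \<comment> \<open>The \<open>k + 1\<close> equal terms are bounded termwise by a geometric
      series, because the ratio is below \<open>1\<close>.\<close>
    also have "(\<Sum>l\<in>{0..k}. (\<rho> / lam) ^ k) \<le> (\<Sum>l\<in>{0..<Suc k}. (\<rho> / lam) ^ l)"
      unfolding atLeastLessThanSuc_atLeastAtMost
      using r by (intro sum_mono power_decreasing) auto
    also have "\<dots> \<le> 1 / (1 - \<rho> / lam)" using sum_power_le[of "\<rho> / lam" 0 "Suc k"] r by simp
    also have "2 * \<beta> ^ h / (1 - \<beta>) \<le> 2 / ((1 - \<beta>) * sqrt \<beta>) * lam ^ k"
    proof -
      have "real n / 2 \<le> real h + 1 / 2" unfolding h_def by linarith
      then have "\<beta> powr (real h + 1 / 2) \<le> \<beta> powr (real n / 2)"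
        using \<beta>_pos \<beta>_less_1 by (intro powr_mono') auto
      also have "\<dots> \<le> lam ^ k" by (rule \<beta>_powr_le[OF n])
      finally have "\<beta> ^ h * sqrt \<beta> \<le> lam ^ k"
        using \<beta>_pos by (simp add: powr_add powr_realpow powr_half_sqrt)
      then have "\<beta> ^ h \<le> lam ^ k / sqrt \<beta>" using \<beta>_pos by (simp add: field_simps)
      then have "2 / (1 - \<beta>) * \<beta> ^ h \<le> 2 / (1 - \<beta>) * (lam ^ k / sqrt \<beta>)"
        using \<beta>_less_1 by (intro mult_left_mono) auto
      then show ?thesis by simp
    qed
    finally show ?thesis using C lam_pos by (simp add: c_def algebra_simps mult_left_mono)
  qed
  ultimately show ?thesis by blast
qed

end

section \<open>The lower bound\<close>

text \<open>The shifted set misses all of \<open>{0..<2 * j}\<close>, and its other missing sums are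
  the old ones translated by \<open>2 * j\<close>.\<close>

lemma card_shift_missing:
  fixes A :: "nat set"
  assumes "0 < N"
  shows "card ({0..<2 * (j + N) - 1} - ((+) j ` A + (+) j ` A)) = 2 * j + card ({0..<2 * N - 1} - (A + A))"
proof -
  have mem: "x \<in> (+) j ` A + (+) j ` A \<longleftrightarrow> 2 * j \<le> x \<and> x - 2 * j \<in> A + A" for x
  proof
    assume "x \<in> (+) j ` A + (+) j ` A"
    then obtain a b where "x = (j + a) + (j + b)" "a \<in> A" "b \<in> A" by (auto elim!: set_plus_elim)
    moreover from this have "x - 2 * j = a + b" by simp
    ultimately show "2 * j \<le> x \<and> x - 2 * j \<in> A + A" by (simp add: set_plus_intro)
  next
    assume x: "2 * j \<le> x \<and> x - 2 * j \<in> A + A"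
    then obtain a b where "x - 2 * j = a + b" "a \<in> A" "b \<in> A" by (auto elim!: set_plus_elim)
    moreover from this x have "x = (j + a) + (j + b)" by linarith
    ultimately show "x \<in> (+) j ` A + (+) j ` A" by (auto intro: set_plus_intro)
  qed
  have "{0..<2 * (j + N) - 1} - ((+) j ` A + (+) j ` A) = {0..<2 * j} \<union> (+) (2 * j) ` ({0..<2 * N - 1} - (A + A))"
  proof (intro equalityI subsetI)
    fix x assume x: "x \<in> {0..<2 * (j + N) - 1} - ((+) j ` A + (+) j ` A)"
    show "x \<in> {0..<2 * j} \<union> (+) (2 * j) ` ({0..<2 * N - 1} - (A + A))"
    proof (cases "2 * j \<le> x")
      case True
      have "x - 2 * j \<notin> A + A" using x mem[of x] True by blast
      moreover have "x - 2 * j < 2 * N - 1" using x True by auto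
      ultimately have "x - 2 * j \<in> {0..<2 * N - 1} - (A + A)" by simp
      then show ?thesis using True by (metis UnCI image_eqI le_add_diff_inverse)
    qed simp
  qed (use assms mem in auto)
  also have "card \<dots> = 2 * j + card ((+) (2 * j) ` ({0..<2 * N - 1} - (A + A)))"
    by (subst card_Un_disjoint) auto
  also have "card ((+) (2 * j) ` ({0..<2 * N - 1} - (A + A))) = card ({0..<2 * N - 1} - (A + A))"
    by (rule card_image) simp
  finally show ?thesis .
qed

text \<open>
  Leaving out \<open>N - 2\<close> costs only the sum \<open>2 * N - 3\<close>, whose unique representation is
  \<open>(N - 1) + (N - 2)\<close>. For \<open>N = 3\<close> the sum \<open>1\<close> would be lost as well.
\<close>

lemma card_missing_fringe:
  fixes A :: "nat set"
  assumes A: "A \<subseteq> {0..<N} - X" and X: "X = {} \<or> X = {N - 2} \<and> 4 \<le> N \<and> 2 \<le> T"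
    and T: "0 < T" "T \<le> N"
    and fringe: "{0..<T} \<union> {N - T..<N} - X \<subseteq> A"
    and middle: "\<And>s. T \<le> s \<Longrightarrow> s < 2 * N - 1 - T \<Longrightarrow> s \<in> A + A"
  shows "card ({0..<2 * N - 1} - (A + A)) = card X"
proof -
  have plus: "s \<in> A + A" if "a \<in> A" "b \<in> A" "s = a + b" for a b s
    using that by (auto intro: set_plus_intro)
  have low: "s \<in> A + A" if "s < T" for s
  proof (cases "s \<in> X")
    case False
    have "0 \<in> A" using fringe T X by auto
    moreover have "s \<in> A" using fringe that False by auto
    ultimately show ?thesis by (rule plus) simp
  next
    case True
    then have "s = N - 2" "X = {N - 2}" "4 \<le> N" "2 \<le> T" using X by auto
    then have "1 \<in> A" "N - 3 \<in> A" using fringe that by auto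
    then show ?thesis by (rule plus) (use \<open>s = N - 2\<close> \<open>4 \<le> N\<close> in simp)
  qed
  have high: "s \<in> A + A" if "2 * N - 1 - T \<le> s" "s < 2 * N - 1" "s - (N - 1) \<notin> X" for s
  proof (rule plus)
    show "N - 1 \<in> A" using fringe T X by auto
    have "s - (N - 1) \<in> {N - T..<N}" using that T by auto
    then show "s - (N - 1) \<in> A" using fringe that by blast
    show "s = N - 1 + (s - (N - 1))" using that T by linarith
  qed
  show ?thesis
  proof (cases "X = {}")
    case True
    have "{0..<2 * N - 1} - (A + A) = {}"
      using low middle high True by (metis Diff_eq_empty_iff atLeastLessThan_iff empty_iff linorder_not_less subsetI)
    then show ?thesis using True by simp
  next
    case False
    then have XN: "X = {N - 2}" "4 \<le> N" "2 \<le> T" using X by auto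
    have "2 * N - 3 \<notin> A + A"
    proof
      assume "2 * N - 3 \<in> A + A"
      then obtain a b where ab: "2 * N - 3 = a + b" "a \<in> A" "b \<in> A" by (rule set_plus_elim)
      then have "a < N" "b < N" "a \<noteq> N - 2" "b \<noteq> N - 2" using A XN by auto
      then show False using ab XN by linarith
    qed
    moreover have "s \<in> A + A" if "s < 2 * N - 1" "s \<noteq> 2 * N - 3" for s
    proof -
      have "s - (N - 1) \<notin> X" if "2 * N - 1 - T \<le> s" using that XN T \<open>s \<noteq> _\<close> by auto
      then show ?thesis using that low middle high by (meson linorder_not_less)
    qed
    moreover have "2 * N - 3 < 2 * N - 1" using XN by linarith
    ultimately have "{0..<2 * N - 1} - (A + A) = {2 * N - 3}"
      unfolding set_eq_iff Diff_iff atLeastLessThan_iff singleton_iff by (metis zero_le)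
    then show ?thesis using XN by simp
  qed
qed

context bernoulli
begin

lemma subset_prob_no_element:
  assumes "finite V"
  shows "subset_prob V (\<lambda>A. A = {}) = (1 - p) ^ card V"
  using assms
proof (induction V rule: finite_induct)
  case empty
  then show ?case by (simp add: indicator_def)
next
  case (insert x V)
  then have "subset_prob (insert x V) (\<lambda>A. A = {}) = (1 - p) * subset_prob V (\<lambda>A. A = {})"
    by (subst subset_prob_insert) auto
  then show ?case using insert by simp
qed

text \<open>Prescribe \<open>A\<close> on fringes of bounded length and on \<open>X\<close>.
  Independently of that, all middle sums are present with probability at least
  \<open>1 / 2\<close>.\<close>

lemma missing_sums_few:
  "\<exists>c>0. \<forall>(N :: nat) X. 0 < N \<longrightarrow> X = {} \<or> X = {N - 2} \<and> 4 \<le> N \<longrightarrow>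
    c \<le> subset_prob {0..<N} (\<lambda>A. card ({0..<2 * N - 1} - (A + A)) = card X)"
proof -
  \<comment> \<open>\<open>T0\<close> will make the union bound over the middle sums at most
    \<open>1 / 2\<close>; the divisor \<open>\<beta> ^ 4\<close> accounts for the at most one
    element of \<open>X\<close>.\<close>
  have "(\<lambda>T. 2 * \<beta> ^ T / (1 - \<beta>) / \<beta> ^ 4) \<longlonglongrightarrow> 2 * 0 / (1 - \<beta>) / \<beta> ^ 4"
    using \<beta>_pos \<beta>_less_1 by (intro tendsto_intros LIMSEQ_power_zero) auto
  then have "eventually (\<lambda>T. 2 * \<beta> ^ T / (1 - \<beta>) / \<beta> ^ 4 < 1 / 2) sequentially"
    by (rule order_tendstoD) simp
  then obtain T0 where T0: "2 * \<beta> ^ T0 / (1 - \<beta>) / \<beta> ^ 4 < 1 / 2" "2 \<le> T0"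
    unfolding eventually_sequentially by (metis max.cobounded1 max.cobounded2)
  define m where "m = min p (1 - p)"
  have m: "0 < m" "m \<le> 1" using p_pos p_less_1 by (auto simp: m_def)
  have "m ^ (2 * T0 + 1) / 2 \<le> subset_prob {0..<N} (\<lambda>A. card ({0..<2 * N - 1} - (A + A)) = card X)"
    if N: "0 < N" and X: "X = {} \<or> X = {N - 2} \<and> 4 \<le> N" for N :: nat and X
  proof -
    \<comment> \<open>If \<open>N \<le> T0\<close>, the fringes fill \<open>{0..<N}\<close> and no
      middle sum remains to be checked.\<close>
    define T where "T = min T0 N"
    define S where "S = {0..<T} \<union> {N - T..<N} - X"
    define W where "W = {0..<N} - ({0..<T} \<union> {N - T..<N} \<union> X)"
    \<comment> \<open>Joining the prescribed set \<open>S\<close> lets \<open>G\<close> be tested on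
      \<open>A \<inter> W\<close> alone, which gives independence from the fringes.\<close>
    define G where "G = (\<lambda>A. \<forall>s\<in>{T..<2 * N - 1 - T}. s \<in> (A \<union> S) + (A \<union> S))"
    have T: "0 < T" "T \<le> N" "T \<le> T0" using N T0 by (auto simp: T_def)
    have XT: "X = {} \<or> X = {N - 2} \<and> 4 \<le> N \<and> 2 \<le> T" using X T0 by (auto simp: T_def)
    have XN: "X \<subseteq> {0..<N}" using X by auto
    have fin: "finite (S \<union> X)" "finite W" "(S \<union> X) \<inter> W = {}" using X by (auto simp: S_def W_def)
    have cover: "(S \<union> X) \<union> W = {0..<N}" using XN T by (auto simp: S_def W_def)
    have "subset_prob W (\<lambda>A. \<not> G A) \<le> 1 / 2"
    proof -
      have "subset_prob W (\<lambda>A. \<not> G A) = subset_prob W (\<lambda>A. \<exists>s\<in>{T..<2 * N - 1 - T}. s \<notin> (A \<union> S) + (A \<union> S))"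
        by (rule subset_prob_cong) (simp add: G_def)
      also have "\<dots> \<le> (\<Sum>s\<in>{T..<2 * N - 1 - T}. subset_prob W (\<lambda>A. s \<notin> (A \<union> S) + (A \<union> S)))"
        by (rule subset_prob_union_le) simp
      also have "\<dots> \<le> (\<Sum>s\<in>{T..<2 * N - 1 - T}. \<beta> ^ min s (2 * N - 2 - s) / \<beta> ^ 4)"
      proof (rule sum_mono)
        fix s assume s: "s \<in> {T..<2 * N - 1 - T}"
        have "subset_prob W (\<lambda>A. s \<notin> (A \<union> S) + (A \<union> S)) =
            subset_prob ({0..<N} - X) (\<lambda>A. s \<notin> ((A \<inter> W) \<union> S) + ((A \<inter> W) \<union> S))"
          by (rule subset_prob_Int[symmetric]) (auto simp: W_def)
        also have "\<dots> \<le> subset_prob ({0..<N} - X) (\<lambda>A. s \<notin> A + A)"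
        proof (rule subset_prob_mono)
          fix A assume "A \<subseteq> {0..<N} - X"
          then have "A \<subseteq> (A \<inter> W) \<union> S" using cover by blast
          then show "s \<notin> A + A" if "s \<notin> ((A \<inter> W) \<union> S) + ((A \<inter> W) \<union> S)"
            using that set_plus_mono2 by blast
        qed
        also have "\<dots> \<le> \<beta> ^ min s (2 * N - 2 - s) / \<beta> ^ (4 * card X)"
          using s X by (intro subset_prob_missing) auto
        also have "\<dots> \<le> \<beta> ^ min s (2 * N - 2 - s) / \<beta> ^ 4"
          using \<beta>_pos \<beta>_less_1 X by (intro divide_left_mono power_decreasing) auto
        finally show "subset_prob W (\<lambda>A. s \<notin> (A \<union> S) + (A \<union> S)) \<le> \<beta> ^ min s (2 * N - 2 - s) / \<beta> ^ 4" .
      qed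
      also have "\<dots> \<le> 1 / 2"
      proof (cases "T0 \<le> N")
        case True
        have "(\<Sum>s\<in>{T..<2 * N - 1 - T}. \<beta> ^ min s (2 * N - 2 - s) / \<beta> ^ 4) \<le> 2 * \<beta> ^ T / (1 - \<beta>) / \<beta> ^ 4"
          unfolding sum_divide_distrib[symmetric]
          using \<beta>_pos \<beta>_less_1 by (intro divide_right_mono sum_power_min_le) auto
        then show ?thesis using T0 True by (simp add: T_def)
      qed (simp add: T_def)
      finally show ?thesis .
    qed
    then have G: "1 / 2 \<le> subset_prob W G" by (simp add: subset_prob_Not)
    have "card (S \<union> X) \<le> 2 * T0 + 1"
    proof -
      have "card (S \<union> X) \<le> card ({0..<T} \<union> {N - T..<N} \<union> X)"
        using X by (intro card_mono) (auto simp: S_def)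
      also have "\<dots> \<le> card ({0..<T} \<union> {N - T..<N}) + card X" by (rule card_Un_le)
      also have "\<dots> \<le> card {0..<T} + card {N - T..<N} + card X" by (intro add_right_mono card_Un_le)
      also have "\<dots> \<le> 2 * T0 + 1" using X T by auto
      finally show ?thesis .
    qed
    then have "m ^ (2 * T0 + 1) \<le> m ^ card (S \<union> X)" using m by (intro power_decreasing) auto
    also have "\<dots> \<le> subset_prob (S \<union> X) (\<lambda>A. A = S)"
      unfolding m_def using fin by (intro subset_prob_singleton) auto
    finally have "m ^ (2 * T0 + 1) * (1 / 2) \<le> subset_prob (S \<union> X) (\<lambda>A. A = S) * subset_prob W G"
      using G by (rule mult_mono) auto
    also have "\<dots> = subset_prob ((S \<union> X) \<union> W) (\<lambda>A. A \<inter> (S \<union> X) = S \<and> G (A \<inter> W))"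
      using fin by (rule subset_prob_indep[symmetric])
    also have "\<dots> \<le> subset_prob {0..<N} (\<lambda>A. card ({0..<2 * N - 1} - (A + A)) = card X)"
      unfolding cover
    proof (rule subset_prob_mono)
      fix A assume A: "A \<subseteq> {0..<N}" "A \<inter> (S \<union> X) = S \<and> G (A \<inter> W)"
      then have "A = (A \<inter> W) \<union> S" using cover by blast
      then have mid: "s \<in> A + A" if "T \<le> s" "s < 2 * N - 1 - T" for s
        using A that by (auto simp: G_def)
      have "S \<subseteq> A" using A by blast
      have "A \<inter> X = {}" using A by (auto simp: S_def)
      show "card ({0..<2 * N - 1} - (A + A)) = card X"
        by (rule card_missing_fringe[OF _ XT T(1,2)])
          (use A mid \<open>S \<subseteq> A\<close> \<open>A \<inter> X = {}\<close> in \<open>auto simp: S_def\<close>)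
    qed
    finally show ?thesis by simp
  qed
  then show ?thesis using m by (intro exI[of _ "m ^ (2 * T0 + 1) / 2"]) auto
qed

text \<open>Since \<open>p\<^sup>2 < p\<close>, the quotient of the logarithms exceeds
  \<open>1\<close>.\<close>

lemma size_condition_gt:
  assumes "real n > 2 * (ln (1 - p) / ln (1 - p\<^sup>2)) * real k"
  shows "0 < n" "k = 0 \<or> 2 * k < n"
proof -
  have "1 - p < 1 - p\<^sup>2" using p_pos p_less_1 by (simp add: power2_eq_square)
  then have "ln (1 - p) < ln (1 - p\<^sup>2)" using p_pos p_less_1 by (subst ln_less_cancel_iff) auto
  then have "1 < ln (1 - p) / ln (1 - p\<^sup>2)" using ln_one_minus_sq_neg by (simp add: less_divide_eq)
  then have "2 * 1 * real k \<le> 2 * (ln (1 - p) / ln (1 - p\<^sup>2)) * real k"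
    by (intro mult_right_mono mult_left_mono) auto
  then have "2 * real k < real n" using assms by linarith
  then show "0 < n" "k = 0 \<or> 2 * k < n" by linarith+
qed

lemma missing_sums_prob_lower:
  "\<exists>c>0. \<forall>k n. real n > 2 * (ln (1 - p) / ln (1 - p\<^sup>2)) * real k \<longrightarrow> (n, k) \<noteq> (3, 1) \<longrightarrow>
    c * (1 - p) powr (real k / 2) \<le> missing_sums_prob n p k"
proof -
  obtain c where c: "0 < c" "\<And>(N :: nat) X. 0 < N \<Longrightarrow> X = {} \<or> X = {N - 2} \<and> 4 \<le> N \<Longrightarrow>
      c \<le> subset_prob {0..<N} (\<lambda>A. card ({0..<2 * N - 1} - (A + A)) = card X)"
    using missing_sums_few by blast
  have "c * (1 - p) powr (real k / 2) \<le> missing_sums_prob n p k"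
    if n: "real n > 2 * (ln (1 - p) / ln (1 - p\<^sup>2)) * real k" "(n, k) \<noteq> (3, 1)" for n k
  proof -
    define j where "j = k div 2"
    define N where "N = n - j"
    define X where "X = (if even k then {} else {N - 2})"
    note size = size_condition_gt[OF n(1)]
    have N: "0 < N" "n = j + N" using size by (auto simp: N_def j_def)
    \<comment> \<open>For \<open>k \<ge> 3\<close> this follows from \<open>n > 2 * k\<close>; for
      \<open>k = 1\<close> it is the point where the pair \<open>(3, 1)\<close> has to be
      excluded.\<close>
    have "4 \<le> N" if "odd k"
    proof (cases "k = 1")
      case True
      then show ?thesis using size n(2) by (auto simp: N_def j_def)
    next
      case False
      then have "3 \<le> k" using that by presburger
      then show ?thesis using size by (auto simp: N_def j_def)
    qed
    then have X: "X = {} \<or> X = {N - 2} \<and> 4 \<le> N" by (auto simp: X_def)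
    have k: "k = 2 * j + card X" by (auto simp: X_def j_def)
    let ?H = "\<lambda>B. card ({0..<2 * n - 1} - (B + B)) = k"
    have "(1 - p) powr (real k / 2) \<le> (1 - p) powr real j"
      using p_pos p_less_1 by (intro powr_mono') (auto simp: j_def)
    also have "\<dots> = (1 - p) ^ j" using p_less_1 by (simp add: powr_realpow)
    also have "\<dots> = subset_prob {0..<j} (\<lambda>A. A = {})"
      using subset_prob_no_element[of "{0..<j}"] by simp
    finally have "c * (1 - p) powr (real k / 2) \<le> c * subset_prob {0..<j} (\<lambda>A. A = {})"
      using c by (intro mult_left_mono) auto
    also have "\<dots> \<le> subset_prob {0..<N} (\<lambda>A. ?H ((+) j ` A)) * subset_prob {0..<j} (\<lambda>A. A = {})"
      using c(2)[OF N(1) X] unfolding N(2) card_shift_missing[OF N(1)] k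
      by (intro mult_right_mono) auto
    also have "subset_prob {0..<N} (\<lambda>A. ?H ((+) j ` A)) = subset_prob ((+) j ` {0..<N}) ?H"
      by (rule subset_prob_image[symmetric]) auto
    also have "(+) j ` {0..<N} = {j..<n}" by (simp add: N(2) add.commute)
    also have "subset_prob {j..<n} ?H * subset_prob {0..<j} (\<lambda>A. A = {}) =
        subset_prob ({j..<n} \<union> {0..<j}) (\<lambda>A. ?H (A \<inter> {j..<n}) \<and> A \<inter> {0..<j} = {})"
      by (rule subset_prob_indep[symmetric]) auto
    also have "{j..<n} \<union> {0..<j} = {0..<n}" using N by auto
    also have "subset_prob {0..<n} (\<lambda>A. ?H (A \<inter> {j..<n}) \<and> A \<inter> {0..<j} = {}) \<le> subset_prob {0..<n} ?H"
    proof (rule subset_prob_mono)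
      fix A assume A: "A \<subseteq> {0..<n}" "?H (A \<inter> {j..<n}) \<and> A \<inter> {0..<j} = {}"
      then have "A \<inter> {j..<n} = A" by (fastforce simp: disjoint_iff not_less)
      then show "?H A" using A by simp
    qed
    also have "\<dots> = missing_sums_prob n p k" using size by (simp add: missing_sums_prob_eq)
    finally show ?thesis .
  qed
  then show ?thesis using c(1) by blast
qed

end

theorem theorem1p4:
  fixes p q :: real
  assumes "0 < p" and "p < 1" and "q = 1 - p"
  shows "\<exists>c1 > 0. \<exists>c2 > 0. \<forall>(k :: nat) (n :: nat).
    real n > 2 * (ln (1 - p) / ln (1 - p\<^sup>2)) * real k \<longrightarrow>
      ((n, k) \<noteq> (3, 1) \<longrightarrow> c1 * q powr (real k / 2) \<le> missing_sums_prob n p k) \<and>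
      missing_sums_prob n p k \<le> c2 * ((1 - p + g p) / 2) ^ k"
proof -
  interpret bernoulli p using assms by unfold_locales
  show ?thesis
    using missing_sums_prob_lower missing_sums_prob_upper unfolding assms(3) lam_def by blast
qed

end
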